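(* Let $\alpha\in(0,1]$, $A\in C(\mathbb{R},\mathbb{R}^{n\times n})$, $B\in C_b(\mathbb{R},\mathbb{R}^{n\times n})$. Suppose that $\mathcal{T}^\alpha x=A(t)x$ possesses a Mittag-Leffler dichotomy in $\mathbb{R}_+$: there are a fundamental matrix $X(t)$, a projection matrix $P$ ($P^2=P$) and constants $N_1,N_2,\beta_1,\beta_2>0$ with $$\|X(t)PX^{-1}(s)\|\le N_1\frac{E_\alpha(\beta_1,s)}{E_\alpha(\beta_1,t)},\ t\ge s\ge0,\qquad \|X(t)(I-P)X^{-1}(s)\|\le N_2\frac{E_\alpha(\beta_2,t)}{E_\alpha(\beta_2,s)},\ s\ge t\ge0.$$ Let $N:=\max\{N_1,N_2\}$, with $N\ge1$, and $\beta:=\min\{\beta_1,\beta_2\}$. If $$\varepsilon:=\sup_{t\in\mathbb{R}_+}\|B(t)\|<\frac{\beta}{5N^2},$$ then, with $Y(t)$ the fundamental matrix of $\mathcal{T}^\alpha y=[A(t)+B(t)]y$ such that $Y(0)=I$, there is a projection matrix $Q$ of the same rank as $P$ such that $$\|Y(t)QY^{-1}(s)\|\le\frac{25N^2}{9}\frac{E_\alpha(\beta-3\varepsilon N,s)}{E_\alpha(\beta-3\varepsilon N,t)},\qquad t\ge s\ge0,$$ $$\|Y(t)(I-Q)Y^{-1}(s)\|\le\frac{25N^2}{9}\frac{E_\alpha(\beta-3\varepsilon N,t)}{E_\alpha(\beta-3\varepsilon N,s)},\qquad s\ge t\ge0.$$ Moreover, $$\|Y(t)QY^{-1}(t)-X(t)PX^{-1}(t)\|\le\frac{2\varepsilon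 N^3}{2\beta-5\varepsilon N-2\varepsilon N^2},\qquad t\ge0.$$
   Context: $\mathbb{R}_+=[0,\infty)$; $C_b$ denotes bounded continuous functions; $\|x\|=\sum_i|x_i|$ on $\mathbb{R}^n$ and $\|A\|$ is the maximal absolute column sum of a matrix. For $\alpha\in(0,1]$, $\mathcal{T}^\alpha g(t):=\lim_{\varepsilon\to0}\frac{g(t+\varepsilon|t|^{1-\alpha})-g(t)}{\varepsilon}$ (so $\mathcal{T}^\alpha g(t)=|t|^{1-\alpha}g'(t)$ for $t\ne0$), with $\mathcal{T}^\alpha g(0):=\lim_{t\to0}\mathcal{T}^\alpha g(t)$ if this limit exists; solutions are continuous functions satisfying the equation. A fundamental matrix of a linear equation is an $n\times n$ matrix function whose columns are $n$ linearly independent solutions. $E_\alpha(\lambda,t):=\exp(\lambda t^\alpha/\alpha)$ for $t\ge0$. *)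

theory Defs
  imports "HOL-Analysis.Analysis"
begin

text \<open>The library's \<open>norm\<close> on \<open>real ^ 'n ^ 'n\<close> is the Frobenius norm; the norm used here is the
  operator norm induced by the \<open>l\<^sup>1\<close>-norm on vectors, i.e. the maximal absolute column sum.\<close>

definition colsum_norm :: "real ^ 'n ^ 'n \<Rightarrow> real" where
  "colsum_norm M = Max (range (\<lambda>j. \<Sum>i\<in>UNIV. \<bar>M $ i $ j\<bar>))"

definition has_conformable_derivative_nonzero ::
    "real \<Rightarrow> (real \<Rightarrow> 'a::real_normed_vector) \<Rightarrow> 'a \<Rightarrow> real \<Rightarrow> bool" where
  "has_conformable_derivative_nonzero \<alpha> g D t \<longleftrightarrow>
     ((\<lambda>\<epsilon>. (g (t + \<epsilon> * \<bar>t\<bar> powr (1 - \<alpha>)) - g t) /\<^sub>R \<epsilon>) \<longlongrightarrow> D) (at 0)"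

text \<open>\<open>has_conformable_derivative \<alpha> g D t\<close> says that \<open>T\<^sup>\<alpha> g(t)\<close> exists and equals \<open>D\<close>. At \<open>t = 0\<close>,
  also for \<open>\<alpha> = 1\<close>, the value is the limit of \<open>T\<^sup>\<alpha> g(s)\<close> as \<open>s \<rightarrow> 0\<close>; here \<open>h s\<close> is \<open>T\<^sup>\<alpha> g(s)\<close>,
  which has to exist for \<open>s \<noteq> 0\<close> close to \<open>0\<close>.\<close>

definition has_conformable_derivative ::
    "real \<Rightarrow> (real \<Rightarrow> 'a::real_normed_vector) \<Rightarrow> 'a \<Rightarrow> real \<Rightarrow> bool" where
  "has_conformable_derivative \<alpha> g D t \<longleftrightarrow>
     (if t = 0
      then \<exists>h. (\<forall>\<^sub>F s in at 0. has_conformable_derivative_nonzero \<alpha> g (h s) s) \<and> (h \<longlongrightarrow> D) (at 0)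
      else has_conformable_derivative_nonzero \<alpha> g D t)"

definition conformable_solution ::
    "real \<Rightarrow> (real \<Rightarrow> real ^ 'n ^ 'n) \<Rightarrow> (real \<Rightarrow> real ^ 'n) \<Rightarrow> bool" where
  "conformable_solution \<alpha> A x \<longleftrightarrow>
     continuous_on UNIV x \<and> (\<forall>t. has_conformable_derivative \<alpha> x (A t *v x t) t)"

text \<open>The columns are required to be linearly independent as functions on the real line;
  invertibility of \<open>X t\<close> for every \<open>t\<close> is a consequence, not part of the definition.\<close>

definition fundamental_matrix ::
    "real \<Rightarrow> (real \<Rightarrow> real ^ 'n ^ 'n) \<Rightarrow> (real \<Rightarrow> real ^ 'n ^ 'n) \<Rightarrow> bool" where
  "fundamental_matrix \<alpha> A X \<longleftrightarrow>
     (\<forall>j. conformable_solution \<alpha> A (\<lambda>t. column j (X t))) \<and>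
     (\<forall>c :: 'n \<Rightarrow> real. (\<forall>t. (\<Sum>j\<in>UNIV. c j *\<^sub>R column j (X t)) = 0) \<longrightarrow> (\<forall>j. c j = 0))"

definition mittag_leffler_E :: "real \<Rightarrow> real \<Rightarrow> real \<Rightarrow> real" where
  "mittag_leffler_E \<alpha> c t = exp (c * t powr \<alpha> / \<alpha>)"

definition mittag_leffler_dichotomy ::
    "real \<Rightarrow> (real \<Rightarrow> real ^ 'n ^ 'n) \<Rightarrow> (real \<Rightarrow> real ^ 'n ^ 'n) \<Rightarrow> real ^ 'n ^ 'n \<Rightarrow>
      real \<Rightarrow> real \<Rightarrow> real \<Rightarrow> real \<Rightarrow> bool" where
  "mittag_leffler_dichotomy \<alpha> A X P N1 N2 \<beta>1 \<beta>2 \<longleftrightarrow>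
     fundamental_matrix \<alpha> A X \<and> P ** P = P \<and> N1 > 0 \<and> N2 > 0 \<and> \<beta>1 > 0 \<and> \<beta>2 > 0 \<and>
     (\<forall>t s. 0 \<le> s \<and> s \<le> t \<longrightarrow>
        colsum_norm (X t ** P ** matrix_inv (X s))
          \<le> N1 * (mittag_leffler_E \<alpha> \<beta>1 s / mittag_leffler_E \<alpha> \<beta>1 t)) \<and>
     (\<forall>t s. 0 \<le> t \<and> t \<le> s \<longrightarrow>
        colsum_norm (X t ** (mat 1 - P) ** matrix_inv (X s))
          \<le> N2 * (mittag_leffler_E \<alpha> \<beta>2 t / mittag_leffler_E \<alpha> \<beta>2 s))"

end

(* Everything is expressed in the new time h(t) = t^alpha / alpha, in which the equations become
   x' = h' A x and the Mittag-Leffler dichotomy becomes an exponential one. If y solves the perturbed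
   equation on [s, T], the variation of constants formula for the stable and the unstable part of y
   shows that its norm is dominated by C (a exp(-gamma (h(t) - h(s))) + b exp(-gamma (h(T) - h(t)))),
   where gamma = sqrt(beta^2 - 2 beta N epsilon) and C = 2 beta N / (beta + gamma) are the exponent and
   the constant for which this function solves the comparison equation with equality. For every xi
   there is exactly one eta with the same stable part at time 0 for which Y(t) eta is bounded (solve
   boundary value problems on [0, n] and let n tend to infinity), and Q maps xi to eta. The stable part
   of (I - Q(t)) x and the unstable part of Q(t) x are then small, which bounds Q(t) - P(t) by a
   self-improving inequality and hence the norms of Q(t) and I - Q(t). *)
theory Submission
  imports Defs
begin

section \<open>The norm of column sums\<close>

text \<open>For \<alpha> < 1 the new time has an unbounded derivative at 0 and solutions need not be
  differentiable there. Every argument therefore uses continuity on the closed half-line and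
  derivatives at positive times only, and integrals are replaced by explicit antiderivatives. The
  estimate of a solution is two-sided: its stable part depends on the past back to s, its unstable
  part on the future up to T. A Gronwall argument running in one direction cannot handle this, so
  the largest excess over the claimed bound is examined instead; it reproduces itself with a factor
  2 N \<epsilon> / \<beta> < 1. The announced constants are roundings. The true rate \<gamma> is at
  least \<beta> - 3 \<epsilon> N, the true constant C is at most 5 N / 3, and the norms of Q(t) and
  I - Q(t) are at most 5 N / 3, which together give 25 N^2 / 9.\<close>

definition l1 :: "real ^ 'n \<Rightarrow> real" where
  "l1 x = (\<Sum>i\<in>UNIV. \<bar>x $ i\<bar>)"

lemma l1_nonneg: "0 \<le> l1 x"
  by (simp add: l1_def sum_nonneg)

lemma l1_eq_0_iff: "l1 x = 0 \<longleftrightarrow> x = 0"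
  by (simp add: l1_def sum_nonneg_eq_0_iff vec_eq_iff)

lemma l1_0 [simp]: "l1 0 = 0"
  by (simp add: l1_def)

lemma l1_triangle: "l1 (x + y) \<le> l1 x + l1 y"
  unfolding l1_def sum.distrib[symmetric] by (intro sum_mono) simp

lemma l1_minus: "l1 (- x) = l1 x"
  by (simp add: l1_def)

lemma l1_triangle_diff: "l1 (x - y) \<le> l1 x + l1 y"
  using l1_triangle[of x "- y"] by (simp add: l1_minus)

lemma l1_scaleR: "l1 (c *\<^sub>R x) = \<bar>c\<bar> * l1 x"
  by (simp add: l1_def abs_mult sum_distrib_left)

lemma norm_le_l1: "norm x \<le> l1 x"
  unfolding l1_def by (metis norm_le_l1_cart)

lemma continuous_on_l1 [continuous_intros]:
  "continuous_on S f \<Longrightarrow> continuous_on S (\<lambda>t. l1 (f t))"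
  unfolding l1_def by (intro continuous_intros)

lemma tendsto_l1 [tendsto_intros]: "(f \<longlongrightarrow> a) F \<Longrightarrow> ((\<lambda>t. l1 (f t)) \<longlongrightarrow> l1 a) F"
  unfolding l1_def by (intro tendsto_intros)

lemma l1_mult_vec_le: "l1 (M *v x) \<le> colsum_norm M * l1 x"
proof -
  have col: "(\<Sum>i\<in>UNIV. \<bar>M $ i $ j\<bar>) \<le> colsum_norm M" for j
    unfolding colsum_norm_def by (intro Max_ge) auto
  have "l1 (M *v x) \<le> (\<Sum>i\<in>UNIV. \<Sum>j\<in>UNIV. \<bar>M $ i $ j\<bar> * \<bar>x $ j\<bar>)"
    unfolding l1_def matrix_vector_mult_def
    by (intro sum_mono) (auto intro!: order_trans[OF sum_abs] simp: abs_mult)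
  also have "\<dots> = (\<Sum>j\<in>UNIV. (\<Sum>i\<in>UNIV. \<bar>M $ i $ j\<bar>) * \<bar>x $ j\<bar>)"
    by (subst sum.swap) (simp add: sum_distrib_right)
  also have "\<dots> \<le> (\<Sum>j\<in>UNIV. colsum_norm M * \<bar>x $ j\<bar>)"
    by (intro sum_mono mult_right_mono col) auto
  finally show ?thesis by (simp add: l1_def sum_distrib_left)
qed

text \<open>Testing on basis vectors suffices: they have \<open>l1\<close> norm 1 and are mapped to
  the columns. With \<open>l1_mult_vec_le\<close> this makes \<open>colsum_norm\<close> the operator
  norm of \<open>l1\<close>, so matrix estimates can be carried out on single vectors.\<close>

lemma colsum_norm_leI:
  fixes M :: "real ^ 'n ^ 'n"
  assumes "\<And>x. l1 (M *v x) \<le> c * l1 x"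
  shows "colsum_norm M \<le> c"
proof -
  have "(\<Sum>i\<in>UNIV. \<bar>M $ i $ j\<bar>) \<le> c" for j
  proof -
    have "l1 (axis j 1 :: real ^ 'n) = 1"
      by (simp add: l1_def axis_def if_distrib cong: if_cong)
    then show ?thesis
      using assms[of "axis j 1"] by (simp add: matrix_vector_mult_basis l1_def column_def)
  qed
  then show ?thesis unfolding colsum_norm_def by (subst Max_le_iff) auto
qed

lemma colsum_norm_nonneg: "0 \<le> colsum_norm M"
proof -
  have "(\<Sum>i\<in>UNIV. \<bar>M $ i $ j\<bar>) \<le> colsum_norm M" for j
    unfolding colsum_norm_def by (intro Max_ge) auto
  then show ?thesis by (meson order_trans sum_nonneg abs_ge_zero)
qed

text \<open>Ensures that the supremum \<epsilon> really bounds each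
  \<open>colsum_norm (B t)\<close>. The entrywise bound, dimension times \<open>K\<close>, is crude,
  but only finiteness matters.\<close>

lemma bounded_colsum_norm:
  fixes B :: "real \<Rightarrow> real ^ 'n ^ 'n"
  assumes "bounded (range B)"
  shows "bdd_above (range (\<lambda>t. colsum_norm (B t)))"
proof -
  obtain K where K: "norm (B t) \<le> K" for t
    using assms by (auto simp: bounded_iff)
  have "colsum_norm (B t) \<le> (\<Sum>i\<in>(UNIV::'n set). K)" for t
  proof -
    have "(\<Sum>i\<in>UNIV. \<bar>B t $ i $ j\<bar>) \<le> (\<Sum>i\<in>(UNIV::'n set). K)" for j
    proof (rule sum_mono)
      fix i
      have "\<bar>B t $ i $ j\<bar> \<le> norm (B t $ i)" by (rule component_le_norm_cart)
      also have "\<dots> \<le> norm (B t)" by (rule Finite_Cartesian_Product.norm_nth_le)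
      finally show "\<bar>B t $ i $ j\<bar> \<le> K" using K[of t] by simp
    qed
    then show ?thesis unfolding colsum_norm_def by (subst Max_le_iff) auto
  qed
  then show ?thesis by (auto simp: bdd_above_def)
qed

text \<open>Duality with the sign vector of the increment reduces this to monotonicity of a real function.\<close>

lemma l1_increment_le:
  fixes f f' :: "real \<Rightarrow> real ^ 'n"
  assumes "a \<le> b" and f: "continuous_on {a..b} f" and g: "continuous_on {a..b} g"
    and df: "\<And>u. a < u \<Longrightarrow> u < b \<Longrightarrow> (f has_vector_derivative f' u) (at u)"
    and dg: "\<And>u. a < u \<Longrightarrow> u < b \<Longrightarrow> (g has_real_derivative g' u) (at u)"
    and le: "\<And>u. a < u \<Longrightarrow> u < b \<Longrightarrow> l1 (f' u) \<le> g' u"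
  shows "l1 (f b - f a) \<le> g b - g a"
proof -
  define \<sigma> :: "real ^ 'n" where "\<sigma> = (\<chi> i. sgn ((f b - f a) $ i))"
  have \<sigma>: "\<sigma> \<bullet> (f b - f a) = l1 (f b - f a)"
    by (simp add: \<sigma>_def inner_vec_def l1_def abs_sgn mult.commute)
  have \<sigma>_le: "\<sigma> \<bullet> v \<le> l1 v" for v
    unfolding inner_vec_def l1_def \<sigma>_def
    by (intro sum_mono) (auto simp: sgn_real_def)
  have "g a - \<sigma> \<bullet> f a \<le> g b - \<sigma> \<bullet> f b"
  proof (rule DERIV_nonneg_imp_increasing_open[OF \<open>a \<le> b\<close>])
    fix u assume u: "a < u" "u < b"
    have "((\<lambda>u. g u - \<sigma> \<bullet> f u) has_real_derivative g' u - \<sigma> \<bullet> f' u) (at u)"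
      using bounded_linear.has_vector_derivative[OF bounded_linear_inner_right df[OF u], of \<sigma>]
      by (intro DERIV_diff dg[OF u]) (simp add: has_real_derivative_iff_has_vector_derivative)
    moreover have "0 \<le> g' u - \<sigma> \<bullet> f' u"
      using le[OF u] \<sigma>_le[of "f' u"] by simp
    ultimately show "\<exists>y. ((\<lambda>u. g u - \<sigma> \<bullet> f u) has_real_derivative y) (at u) \<and> 0 \<le> y"
      by blast
  qed (intro continuous_intros f g)
  then show ?thesis using \<sigma> by (simp add: inner_diff_right)
qed

section \<open>Differentiability of inverse matrices\<close>

lemma bounded_bilinear_matrix_vector_mult:
  "bounded_bilinear (\<lambda>(M :: real ^ 'n ^ 'm) x. M *v x)"
  by (auto simp: bilinear_conv_bounded_bilinear[symmetric] bilinear_def linear_iff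
      matrix_vector_mult_add_rdistrib matrix_vector_right_distrib matrix_vector_mult_scaleR
      scaleR_matrix_vector_assoc)

lemmas continuous_on_matrix_vector_mult [continuous_intros] =
  bounded_bilinear.continuous_on[OF bounded_bilinear_matrix_vector_mult]

lemma matrix_inv_right: "invertible M \<Longrightarrow> M ** matrix_inv M = mat 1"
  and matrix_inv_left: "invertible M \<Longrightarrow> matrix_inv M ** M = mat 1"
  for M :: "real ^ 'n ^ 'n"
  unfolding matrix_inv_def invertible_def by (rule someI2_ex; blast)+

text \<open>Cramer's rule displays the solution of a linear system as quotients of polynomials in
  the data, so regularity of the inverse follows from that of determinants.\<close>

lemma matrix_inv_vec_eq_cramer:
  fixes M :: "real ^ 'n ^ 'n"
  assumes "invertible M"
  shows "matrix_inv M *v b =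
    (\<chi> k. det (\<chi> i j. if j = k then b $ i else M $ i $ j) / det M)"
proof -
  have "M *v (matrix_inv M *v b) = b"
    by (simp add: matrix_vector_mul_assoc matrix_inv_right[OF assms])
  then show ?thesis
    using cramer[of M] assms by (simp add: invertible_det_nz)
qed

lemma continuous_on_det:
  fixes M :: "'a::topological_space \<Rightarrow> real ^ 'n ^ 'n"
  assumes "\<And>i j. continuous_on S (\<lambda>u. M u $ i $ j)"
  shows "continuous_on S (\<lambda>u. det (M u))"
  unfolding det_def by (intro continuous_intros assms)

lemma differentiable_prod:
  fixes f :: "'i \<Rightarrow> 'a::real_normed_vector \<Rightarrow> real"
  assumes "\<And>i. i \<in> I \<Longrightarrow> f i differentiable (at u)"
  shows "(\<lambda>u. \<Prod>i\<in>I. f i u) differentiable (at u)"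
  using assms
  by (induction I rule: infinite_finite_induct) (auto intro!: differentiable_mult)

lemma differentiable_det:
  fixes M :: "'a::real_normed_vector \<Rightarrow> real ^ 'n ^ 'n"
  assumes "\<And>i j. (\<lambda>u. M u $ i $ j) differentiable (at t)"
  shows "(\<lambda>u. det (M u)) differentiable (at t)"
  unfolding det_def
  by (auto intro!: differentiable_sum differentiable_mult differentiable_prod assms finite_permutations)

lemma differentiable_nth:
  "f differentiable F \<Longrightarrow> (\<lambda>u. f u $ i) differentiable F"
  unfolding differentiable_def
  using bounded_linear.has_derivative[OF bounded_linear_vec_nth] by blast

lemma differentiable_vec_lambda:
  fixes f :: "'a::real_normed_vector \<Rightarrow> real ^ 'n"
  assumes "\<And>i. (\<lambda>u. f u $ i) differentiable (at t)"
  shows "f differentiable (at t)"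
proof -
  have "f = (\<lambda>u. \<Sum>i\<in>UNIV. (f u $ i) *\<^sub>R axis i 1)"
    by (simp add: fun_eq_iff basis_expansion scalar_mult_eq_scaleR[symmetric])
  moreover have "(\<lambda>u. \<Sum>i\<in>UNIV. (f u $ i) *\<^sub>R (axis i 1 :: real ^ 'n)) differentiable (at t)"
    by (intro differentiable_sum ballI differentiable_scaleR assms differentiable_const) auto
  ultimately show ?thesis by simp
qed

lemma continuous_on_matrix_inv_vec:
  fixes X :: "real \<Rightarrow> real ^ 'n ^ 'n"
  assumes X: "continuous_on S X" and y: "continuous_on S y"
    and inv: "\<And>u. u \<in> S \<Longrightarrow> invertible (X u)"
  shows "continuous_on S (\<lambda>u. matrix_inv (X u) *v y u)"
proof -
  have "continuous_on S (\<lambda>u. \<chi> k. det (\<chi> i j. if j = k then y u $ i else X u $ i $ j) / det (X u))"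
  proof (intro continuous_on_vec_lambda continuous_on_divide continuous_on_det)
    fix i j k
    show "continuous_on S (\<lambda>u. (\<chi> i j. if j = k then y u $ i else X u $ i $ j) $ i $ j)"
      using X y by (cases "j = k") (auto intro!: continuous_intros)
  qed (use inv X in \<open>auto intro!: continuous_intros simp: invertible_det_nz\<close>)
  then show ?thesis
    by (subst continuous_on_cong[OF refl matrix_inv_vec_eq_cramer]) (auto intro: inv)
qed

text \<open>Cramer's formula is valid only where the matrix is invertible, hence the open set.
  Existence of a derivative is enough: its value is found later from the product rule.\<close>

lemma differentiable_matrix_inv_vec:
  fixes X :: "real \<Rightarrow> real ^ 'n ^ 'n"
  assumes X: "X differentiable (at t)" and y: "y differentiable (at t)"
    and S: "open S" "t \<in> S" and inv: "\<And>u. u \<in> S \<Longrightarrow> invertible (X u)"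
  shows "(\<lambda>u. matrix_inv (X u) *v y u) differentiable (at t)"
proof -
  have "(\<lambda>u. \<chi> k. det (\<chi> i j. if j = k then y u $ i else X u $ i $ j) / det (X u))
      differentiable (at t)" (is "?f differentiable _")
  proof (rule differentiable_vec_lambda)
    fix k
    have "(\<lambda>u. (\<chi> i j. if j = k then y u $ i else X u $ i $ j) $ i $ j) differentiable (at t)"
      for i j
      using X y by (cases "j = k") (auto intro: differentiable_nth)
    then have "(\<lambda>u. det (\<chi> i j. if j = k then y u $ i else X u $ i $ j)) differentiable (at t)"
      by (rule differentiable_det)
    moreover have "(\<lambda>u. det (X u)) differentiable (at t)"
      by (intro differentiable_det differentiable_nth X)
    ultimately show "(\<lambda>u. ?f u $ k) differentiable (at t)"
      using inv[OF S(2)] by (simp add: differentiable_divide invertible_det_nz)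
  qed
  then obtain D where "(?f has_derivative D) (at t)" by (auto simp: differentiable_def)
  then have "((\<lambda>u. matrix_inv (X u) *v y u) has_derivative D) (at t)"
    by (rule has_derivative_transform_within_open[OF _ S])
       (simp add: matrix_inv_vec_eq_cramer inv)
  then show ?thesis by (auto simp: differentiable_def)
qed

section \<open>Linear equations in a changed time\<close>

text \<open>At 0 only continuity of \<open>h\<close> is required, because t^\<alpha> / \<alpha> has
  the derivative t^(\<alpha> - 1), which blows up there for \<alpha> < 1. Divergence of
  \<open>h\<close> makes boundary terms at T vanish as T tends to infinity.\<close>

locale time_change =
  fixes h k :: "real \<Rightarrow> real"
  assumes cont_h: "continuous_on {0..} h"
    and deriv_h: "0 < t \<Longrightarrow> (h has_real_derivative k t) (at t)"
    and k_nonneg: "0 < t \<Longrightarrow> 0 \<le> k t"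
    and h_at_top: "filterlim h at_top at_top"
begin

lemma h_mono: "0 \<le> s \<Longrightarrow> s \<le> t \<Longrightarrow> h s \<le> h t"
  by (rule DERIV_nonneg_imp_increasing_open)
     (auto intro!: exI[of _ "k _"] deriv_h k_nonneg continuous_on_subset[OF cont_h])

definition solves :: "(real \<Rightarrow> real ^ 'n ^ 'n) \<Rightarrow> (real \<Rightarrow> real ^ 'n) \<Rightarrow> bool" where
  "solves A x \<longleftrightarrow> continuous_on {0..} x \<and>
     (\<forall>t>0. (x has_vector_derivative k t *\<^sub>R (A t *v x t)) (at t))"

text \<open>On a compact interval the squared norm of \<open>x\<close> changes at a rate of at most
  \<open>2 * M * k\<close> times itself. Multiplied by \<open>exp (- 2 * M * h u)\<close> it
  decreases, by \<open>exp (2 * M * h u)\<close> it increases, so a zero spreads forwards and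
  backwards. The possibly unbounded \<open>k\<close> is absorbed by \<open>h\<close> in the
  exponent.\<close>

lemma solves_eq_0:
  fixes A :: "real \<Rightarrow> real ^ 'n ^ 'n"
  assumes x: "solves A x" and A: "continuous_on {0..} A"
    and "0 \<le> t0" "x t0 = 0" "0 \<le> t"
  shows "x t = 0"
proof -
  define T where "T = max t t0"
  have "compact (A ` {0..T})"
    by (intro compact_continuous_image continuous_on_subset[OF A]) auto
  then obtain R where R: "0 < R" "\<And>u. u \<in> {0..T} \<Longrightarrow> norm (A u) \<le> R"
    using compact_imp_bounded[of "A ` {0..T}"] unfolding bounded_pos by blast
  obtain K where K: "0 < K" "\<And>(L :: real ^ 'n ^ 'n) w. norm (L *v w) \<le> norm L * norm w * K"
    using bounded_bilinear.pos_bounded[OF bounded_bilinear_matrix_vector_mult] by blast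
  define M where "M = R * K"
  have inner_le: "\<bar>w \<bullet> (A u *v w)\<bar> \<le> M * (w \<bullet> w)" if "u \<in> {0..T}" for u w
  proof -
    have "\<bar>w \<bullet> (A u *v w)\<bar> \<le> norm w * norm (A u *v w)" by (rule Cauchy_Schwarz_ineq2)
    also have "\<dots> \<le> norm w * (R * norm w * K)"
      by (intro mult_left_mono order_trans[OF K(2)] mult_right_mono R that) (use K in auto)
    finally show ?thesis
      by (simp add: M_def dot_square_norm power2_eq_square mult_ac)
  qed
  define E where "E c u = (x u \<bullet> x u) * exp (c * h u)" for c u
  define E' where "E' c u = exp (c * h u) * k u * (2 * (x u \<bullet> (A u *v x u)) + c * (x u \<bullet> x u))"
    for c u
  have dE: "(E c has_real_derivative E' c u) (at u)" if "0 < u" for c u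
  proof -
    have dx: "(x has_vector_derivative k u *\<^sub>R (A u *v x u)) (at u)"
      using x that by (auto simp: solves_def)
    have "((\<lambda>u. x u \<bullet> x u) has_real_derivative 2 * k u * (x u \<bullet> (A u *v x u))) (at u)"
      using bounded_bilinear.has_vector_derivative[OF bounded_bilinear_inner dx dx]
      by (simp add: has_real_derivative_iff_has_vector_derivative inner_commute mult.assoc)
    then show ?thesis
      unfolding E_def E'_def
      by (auto intro!: derivative_eq_intros deriv_h that simp: algebra_simps)
  qed
  have cE: "continuous_on {a..b} (E c)" if "0 \<le> a" for a b c
  proof -
    have "continuous_on {a..b} x" "continuous_on {a..b} h"
      using x cont_h that by (auto simp: solves_def intro: continuous_on_subset)
    then show ?thesis unfolding E_def by (intro continuous_intros)
  qed
  have "x t \<bullet> x t \<le> 0"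
  proof (cases "t0 \<le> t")
    case True
    have "E (- 2 * M) t0 \<ge> E (- 2 * M) t"
    proof (rule DERIV_nonpos_imp_decreasing_open[OF True _ cE])
      fix u assume u: "t0 < u" "u < t"
      have "E' (- 2 * M) u \<le> 0"
        unfolding E'_def using inner_le[of u "x u"] u assms k_nonneg[of u]
        by (intro mult_nonneg_nonpos) (auto simp: T_def)
      then show "\<exists>y. (E (- 2 * M) has_real_derivative y) (at u) \<and> y \<le> 0"
        using dE u assms by (intro exI[of _ "E' (- 2 * M) u"]) auto
    qed (use assms in auto)
    then show ?thesis using assms by (simp add: E_def mult_le_0_iff)
  next
    case False
    have "E (2 * M) t \<le> E (2 * M) t0"
    proof (rule DERIV_nonneg_imp_increasing_open[OF _ _ cE])
      fix u assume u: "t < u" "u < t0"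
      have "0 \<le> E' (2 * M) u"
        unfolding E'_def using inner_le[of u "x u"] u assms k_nonneg[of u]
        by (intro mult_nonneg_nonneg) (auto simp: T_def)
      then show "\<exists>y. (E (2 * M) has_real_derivative y) (at u) \<and> 0 \<le> y"
        using dE u assms by (intro exI[of _ "E' (2 * M) u"]) auto
    qed (use assms False in auto)
    then show ?thesis using assms by (simp add: E_def mult_le_0_iff)
  qed
  then show ?thesis by (metis inner_eq_zero_iff inner_ge_zero order_antisym)
qed

end

section \<open>Perturbation of a dichotomy\<close>

locale dichotomy_perturbation = time_change +
  fixes A B X Y :: "real \<Rightarrow> real ^ 'n ^ 'n" and P :: "real ^ 'n ^ 'n" and N \<beta> \<epsilon> :: real
  assumes cont_X: "continuous_on {0..} X" and cont_Y: "continuous_on {0..} Y"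
    and deriv_X: "0 < t \<Longrightarrow> (X has_vector_derivative k t *\<^sub>R (A t ** X t)) (at t)"
    and deriv_Y: "0 < t \<Longrightarrow> (Y has_vector_derivative k t *\<^sub>R ((A t + B t) ** Y t)) (at t)"
    and inv_X: "0 \<le> t \<Longrightarrow> invertible (X t)" and inv_Y: "0 \<le> t \<Longrightarrow> invertible (Y t)"
    and Y_0: "Y 0 = mat 1"
    and P_proj: "P ** P = P"
    and stable: "0 \<le> s \<Longrightarrow> s \<le> t \<Longrightarrow>
      colsum_norm (X t ** P ** matrix_inv (X s)) \<le> N * exp (- \<beta> * (h t - h s))"
    and unstable: "0 \<le> t \<Longrightarrow> t \<le> s \<Longrightarrow>
      colsum_norm (X t ** (mat 1 - P) ** matrix_inv (X s)) \<le> N * exp (- \<beta> * (h s - h t))"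
    and B_le: "0 \<le> t \<Longrightarrow> colsum_norm (B t) \<le> \<epsilon>"
    and N_ge_1: "1 \<le> N" and \<beta>_pos: "0 < \<beta>" and \<epsilon>_small: "5 * N\<^sup>2 * \<epsilon> < \<beta>"
begin

section \<open>Evolution operators and the constants of the comparison equation\<close>

definition S :: "real \<Rightarrow> real \<Rightarrow> real ^ 'n ^ 'n" where
  "S t s = X t ** P ** matrix_inv (X s)"

definition U :: "real \<Rightarrow> real \<Rightarrow> real ^ 'n ^ 'n" where
  "U t s = X t ** (mat 1 - P) ** matrix_inv (X s)"

text \<open>In the time \<open>h\<close>, the comparison equation has the kernel
  \<open>N * \<epsilon> * exp (- \<beta> * \<bar>h t - h u\<bar>)\<close>. Differentiating it twice
  gives \<phi>'' = (\<beta>^2 - 2 \<beta> N \<epsilon>) \<phi>, whose characteristic exponents are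
  \<open>\<gamma>\<close> and \<open>- \<gamma>\<close>.\<close>

definition \<gamma> :: real where "\<gamma> = sqrt (\<beta>\<^sup>2 - 2 * \<beta> * N * \<epsilon>)"

text \<open>\<open>p\<close> and \<open>q\<close> are chosen such that \<open>\<phi> t = N / p * exp (- \<gamma> * (h t - h s))\<close> solves the integral
  equation that dominates the norm of a decaying solution of the perturbed equation.\<close>

definition p :: real where "p = (\<beta> + \<gamma>) / (2 * \<beta>)"
definition q :: real where "q = (\<beta> - \<gamma>) / (2 * \<beta>)"

lemma \<epsilon>_nonneg: "0 \<le> \<epsilon>"
  using colsum_norm_nonneg[of "B 0"] B_le[of 0] by simp

lemma N\<epsilon>_nonneg: "0 \<le> N * \<epsilon>"
  using N_ge_1 \<epsilon>_nonneg by simp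

lemma N\<epsilon>_small: "5 * (N * \<epsilon>) < \<beta>" "5 * N * (N * \<epsilon>) < \<beta>"
proof -
  show 2: "5 * N * (N * \<epsilon>) < \<beta>"
    using \<epsilon>_small by (simp add: power2_eq_square mult_ac)
  have "N * \<epsilon> \<le> N * (N * \<epsilon>)"
    using mult_right_mono[OF N_ge_1 N\<epsilon>_nonneg] by simp
  then show "5 * (N * \<epsilon>) < \<beta>" using 2 by simp
qed

lemma \<gamma>_sq: "\<gamma>\<^sup>2 = \<beta>\<^sup>2 - 2 * \<beta> * N * \<epsilon>"
proof -
  have "\<beta> * (2 * (N * \<epsilon>)) \<le> \<beta> * \<beta>"
    using N\<epsilon>_small N_ge_1 \<epsilon>_nonneg \<beta>_pos by (intro mult_left_mono) auto
  then show ?thesis unfolding \<gamma>_def by (simp add: power2_eq_square mult_ac)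
qed

text \<open>After squaring, the claim is 9 (N \<epsilon>)^2 \<le> 4 \<beta> N \<epsilon>, which
  holds since 5 N \<epsilon> < \<beta>.\<close>

lemma \<gamma>_ge: "\<beta> - 3 * \<epsilon> * N \<le> \<gamma>"
proof -
  have "9 * (N * \<epsilon>) * (N * \<epsilon>) \<le> 4 * \<beta> * (N * \<epsilon>)"
    using N\<epsilon>_small(1) N\<epsilon>_nonneg by (intro mult_right_mono) linarith+
  then show ?thesis
    unfolding \<gamma>_def by (intro real_le_rsqrt) (simp add: power2_eq_square algebra_simps)
qed

text \<open>The lower bound keeps \<open>p\<close> above 7/10 and thus \<open>N / p\<close> below
  5/3 N, one of the two factors in 25 N^2 / 9.\<close>

lemma \<gamma>_bounds: "2 / 5 * \<beta> \<le> \<gamma>" "\<gamma> \<le> \<beta>"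
proof -
  show "2 / 5 * \<beta> \<le> \<gamma>" using \<gamma>_ge N\<epsilon>_small(1) by (simp add: mult_ac)
  show "\<gamma> \<le> \<beta>"
    unfolding \<gamma>_def using \<beta>_pos N_ge_1 \<epsilon>_nonneg by (intro real_le_lsqrt) auto
qed

lemma p_q: "p + q = 1" "2 * \<beta> * p = \<beta> + \<gamma>" "2 * \<beta> * q = \<beta> - \<gamma>" "7 / 10 \<le> p" "0 \<le> q"
  using \<beta>_pos \<gamma>_bounds by (auto simp: p_def q_def field_simps)

text \<open>For a decaying exponential of rate \<open>\<gamma>\<close>, \<open>p\<close> is the
  share reproduced by integrating the kernel over the past and \<open>q\<close> the share from the
  future. The product form also covers \<epsilon> = 0, where \<open>\<gamma> = \<beta>\<close> and a
  quotient by \<open>\<beta> - \<gamma>\<close> would be meaningless.\<close>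

lemma p_q_\<epsilon>: "p * (\<beta> - \<gamma>) = N * \<epsilon>" "q * (\<beta> + \<gamma>) = N * \<epsilon>"
  using \<beta>_pos \<gamma>_sq by (auto simp: p_def q_def field_simps power2_eq_square)

section \<open>Variation of constants for the stable and the unstable part\<close>

lemma solution_cont: "continuous_on {0..} (\<lambda>t. Y t *v \<eta>)"
  by (intro continuous_intros cont_Y)

lemma solution_cont_subset: "0 \<le> a \<Longrightarrow> continuous_on {a..b} (\<lambda>t. Y t *v \<eta>)"
  by (rule continuous_on_subset[OF solution_cont]) auto

lemma h_cont_subset: "0 \<le> a \<Longrightarrow> continuous_on {a..b} h"
  by (rule continuous_on_subset[OF cont_h]) auto

lemma l1_S_le: "0 \<le> s \<Longrightarrow> s \<le> t \<Longrightarrow> l1 (S t s *v v) \<le> N * exp (- \<beta> * (h t - h s)) * l1 v"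
  unfolding S_def by (rule order_trans[OF l1_mult_vec_le mult_right_mono[OF stable l1_nonneg]])

lemma l1_U_le: "0 \<le> t \<Longrightarrow> t \<le> s \<Longrightarrow> l1 (U t s *v v) \<le> N * exp (- \<beta> * (h s - h t)) * l1 v"
  unfolding U_def by (rule order_trans[OF l1_mult_vec_le mult_right_mono[OF unstable l1_nonneg]])

lemma l1_B_le: "0 \<le> t \<Longrightarrow> l1 (B t *v v) \<le> \<epsilon> * l1 v"
  by (rule order_trans[OF l1_mult_vec_le mult_right_mono[OF B_le l1_nonneg]])

lemma variation_cont:
  "0 \<le> a \<Longrightarrow> continuous_on {a..b} (\<lambda>u. L ** matrix_inv (X u) *v (Y u *v \<eta>))"
  unfolding matrix_vector_mul_assoc[symmetric, of L]
  by (intro continuous_intros continuous_on_matrix_inv_vec solution_cont_subset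
      continuous_on_subset[OF cont_X]) (auto intro: inv_X)

text \<open>This is variation of constants in differential form. With z = X^(-1) Y \<eta>,
  differentiate X z = Y \<eta>: the terms with A cancel and X z' = k B Y \<eta> remains.\<close>

lemma variation_deriv:
  assumes "0 < u"
  shows "((\<lambda>u. L ** matrix_inv (X u) *v (Y u *v \<eta>)) has_vector_derivative
    k u *\<^sub>R (L ** matrix_inv (X u) *v (B u *v (Y u *v \<eta>)))) (at u)"
proof -
  define z where "z u = matrix_inv (X u) *v (Y u *v \<eta>)" for u
  have dX: "(X has_vector_derivative k u *\<^sub>R (A u ** X u)) (at u)"
    using deriv_X assms .
  have dY: "((\<lambda>u. Y u *v \<eta>) has_vector_derivative k u *\<^sub>R ((A u + B u) *v (Y u *v \<eta>))) (at u)"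
    using bounded_linear.has_vector_derivative[OF
        bounded_bilinear.bounded_linear_left[OF bounded_bilinear_matrix_vector_mult] deriv_Y[OF assms], of \<eta>]
    by (simp add: scaleR_matrix_vector_assoc[symmetric] matrix_vector_mul_assoc)
  have "z differentiable (at u)"
    unfolding z_def
    by (rule differentiable_matrix_inv_vec[of _ _ _ "{0<..}"])
       (use dX dY assms inv_X in \<open>auto simp: has_vector_derivative_def differentiable_def\<close>)
  then obtain z' where dz: "(z has_vector_derivative z') (at u)"
    using vector_derivative_works by blast
  have Xz: "X u *v z u = Y u *v \<eta>" if "0 < u" for u
    using matrix_inv_right[OF inv_X, of u] that by (simp add: z_def matrix_vector_mul_assoc matrix_mul_assoc)
  have "((\<lambda>u. X u *v z u) has_vector_derivative X u *v z' + (k u *\<^sub>R (A u ** X u)) *v z u) (at u)"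
    by (rule bounded_bilinear.has_vector_derivative[OF bounded_bilinear_matrix_vector_mult dX dz])
  then have "((\<lambda>u. Y u *v \<eta>) has_vector_derivative X u *v z' + (k u *\<^sub>R (A u ** X u)) *v z u) (at u)"
    by (rule has_vector_derivative_transform_within_open[of _ _ _ "{0<..}"]) (use assms Xz in auto)
  with dY have "k u *\<^sub>R ((A u + B u) *v (Y u *v \<eta>)) = X u *v z' + (k u *\<^sub>R (A u ** X u)) *v z u"
    by (rule vector_derivative_unique_at)
  then have "X u *v z' = k u *\<^sub>R (B u *v (Y u *v \<eta>))"
    using Xz[OF assms]
    by (simp add: scaleR_matrix_vector_assoc[symmetric] matrix_vector_mul_assoc[symmetric]
        matrix_vector_mult_add_rdistrib scaleR_right_distrib)
  then have "matrix_inv (X u) *v (X u *v z') = k u *\<^sub>R (matrix_inv (X u) *v (B u *v (Y u *v \<eta>)))"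
    by (simp add: matrix_vector_mult_scaleR)
  then have "z' = k u *\<^sub>R (matrix_inv (X u) *v (B u *v (Y u *v \<eta>)))"
    using matrix_inv_left[OF inv_X] assms by (simp add: matrix_vector_mul_assoc)
  with bounded_linear.has_vector_derivative[OF matrix_vector_mul_bounded_linear dz, of L]
  show ?thesis
    by (simp add: z_def matrix_vector_mul_assoc[symmetric, of L] matrix_vector_mult_scaleR)
qed

text \<open>\<open>G t - G s\<close> stands for the integral of \<open>k * g\<close>. Supplying an
  antiderivative avoids all questions of integrability of \<open>k\<close> near 0.\<close>

lemma l1_S_solution_le:
  assumes "0 \<le> s" "s \<le> t" and G: "continuous_on {s..t} G"
    and dG: "\<And>u. s < u \<Longrightarrow> u < t \<Longrightarrow> (G has_real_derivative k u * g u) (at u)"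
    and le: "\<And>u. s < u \<Longrightarrow> u < t \<Longrightarrow>
      N * \<epsilon> * exp (- \<beta> * (h t - h u)) * l1 (Y u *v \<eta>) \<le> g u"
  shows "l1 (S t t *v (Y t *v \<eta>)) \<le> l1 (S t s *v (Y s *v \<eta>)) + G t - G s"
proof -
  have "l1 (S t t *v (Y t *v \<eta>) - S t s *v (Y s *v \<eta>)) \<le> G t - G s"
    unfolding S_def
  proof (rule l1_increment_le[OF \<open>s \<le> t\<close> _ G _ dG])
    fix u assume u: "s < u" "u < t"
    have "l1 (S t u *v (B u *v (Y u *v \<eta>))) \<le>
        N * exp (- \<beta> * (h t - h u)) * (\<epsilon> * l1 (Y u *v \<eta>))"
      using u assms N_ge_1 by (intro order_trans[OF l1_S_le mult_left_mono] l1_B_le) auto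
    with le[OF u] have "l1 (S t u *v (B u *v (Y u *v \<eta>))) \<le> g u"
      by (simp add: mult_ac)
    then show "l1 (k u *\<^sub>R (X t ** P ** matrix_inv (X u) *v (B u *v (Y u *v \<eta>)))) \<le> k u * g u"
      using u assms k_nonneg[of u] by (simp add: l1_scaleR S_def mult_left_mono)
  qed (use assms in \<open>auto intro!: variation_cont variation_deriv\<close>)
  then show ?thesis
    using l1_triangle[of "S t t *v (Y t *v \<eta>) - S t s *v (Y s *v \<eta>)" "S t s *v (Y s *v \<eta>)"]
    by simp
qed

text \<open>The mirror image: the unstable part is controlled from the right end \<open>T\<close>,
  so here \<open>G\<close> decreases and \<open>- G\<close> is the antiderivative.\<close>

lemma l1_U_solution_le:
  assumes "0 \<le> t" "t \<le> T" and G: "continuous_on {t..T} G"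
    and dG: "\<And>u. t < u \<Longrightarrow> u < T \<Longrightarrow> (G has_real_derivative - (k u * g u)) (at u)"
    and le: "\<And>u. t < u \<Longrightarrow> u < T \<Longrightarrow>
      N * \<epsilon> * exp (- \<beta> * (h u - h t)) * l1 (Y u *v \<eta>) \<le> g u"
  shows "l1 (U t t *v (Y t *v \<eta>)) \<le> l1 (U t T *v (Y T *v \<eta>)) + G t - G T"
proof -
  have "l1 (U t T *v (Y T *v \<eta>) - U t t *v (Y t *v \<eta>)) \<le> - G T - (- G t)"
    unfolding U_def
  proof (rule l1_increment_le[OF \<open>t \<le> T\<close> _ continuous_on_minus[OF G] _ DERIV_minus[OF dG]])
    fix u assume u: "t < u" "u < T"
    have "l1 (U t u *v (B u *v (Y u *v \<eta>))) \<le>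
        N * exp (- \<beta> * (h u - h t)) * (\<epsilon> * l1 (Y u *v \<eta>))"
      using u assms N_ge_1 by (intro order_trans[OF l1_U_le mult_left_mono] l1_B_le) auto
    with le[OF u] have "l1 (U t u *v (B u *v (Y u *v \<eta>))) \<le> g u"
      by (simp add: mult_ac)
    then show "l1 (k u *\<^sub>R (X t ** (mat 1 - P) ** matrix_inv (X u) *v (B u *v (Y u *v \<eta>))))
        \<le> - (- (k u * g u))"
      using u assms k_nonneg[of u] by (simp add: l1_scaleR U_def mult_left_mono)
  qed (use assms in \<open>auto intro!: variation_cont variation_deriv\<close>)
  then show ?thesis
    using l1_triangle_diff[of "U t T *v (Y T *v \<eta>)" "U t T *v (Y T *v \<eta>) - U t t *v (Y t *v \<eta>)"]
    by simp
qed

section \<open>Complementary projections and the comparison bound\<close>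

lemma S_plus_U: "0 \<le> t \<Longrightarrow> S t t *v v + U t t *v v = v"
  using matrix_inv_right[OF inv_X, of t]
  by (simp add: S_def U_def matrix_vector_mul_assoc[symmetric] matrix_vector_mult_diff_rdistrib
      matrix_vector_mult_diff_distrib) (simp add: matrix_vector_mul_assoc)

lemma l1_le_S_U: "0 \<le> t \<Longrightarrow> l1 v \<le> l1 (S t t *v v) + l1 (U t t *v v)"
  using l1_triangle[of "S t t *v v" "U t t *v v"] by (simp add: S_plus_U)

lemma S_S: "0 \<le> r \<Longrightarrow> S t r *v (S r s *v v) = S t s *v v"
  unfolding S_def matrix_vector_mul_assoc
  by (metis P_proj inv_X matrix_inv_left matrix_mul_assoc matrix_mul_rid)

lemma S_U: "0 \<le> r \<Longrightarrow> S t r *v (U r s *v v) = 0"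
proof -
  assume "0 \<le> r"
  then have "P ** matrix_inv (X r) ** (X r ** (mat 1 - P)) = P ** (mat 1 - P)"
    by (metis inv_X matrix_inv_left matrix_mul_assoc matrix_mul_rid)
  also have "\<dots> = 0"
    by (simp add: matrix_eq matrix_vector_mul_assoc[symmetric] matrix_vector_mult_diff_rdistrib
        matrix_vector_mult_diff_distrib) (simp add: matrix_vector_mul_assoc P_proj)
  finally show ?thesis
    by (simp add: S_def U_def matrix_vector_mul_assoc matrix_mul_assoc)
       (metis matrix_mul_assoc matrix_vector_mul_assoc matrix_vector_mult_0 matrix_vector_mult_0_right)
qed

text \<open>Let \<open>\<phi>\<close> be the claimed bound and \<open>m\<close> the largest value of \<open>l1 (Y u *v \<eta>) - \<phi> u\<close>. Inserting
  \<open>l1 (Y u *v \<eta>) \<le> \<phi> u + m\<close> into the variation of constants formula reproduces \<open>\<phi>\<close> and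
  turns \<open>m\<close> into \<open>2 * N * \<epsilon> / \<beta> * m\<close>, hence \<open>m \<le> 0\<close>.\<close>

lemma solution_bound:
  assumes "0 \<le> s" "s \<le> t" "t \<le> T" and ab: "0 \<le> a" "0 \<le> b"
    and a: "\<And>t. s \<le> t \<Longrightarrow> t \<le> T \<Longrightarrow>
      l1 (S t s *v (Y s *v \<eta>)) \<le> N * a * exp (- \<beta> * (h t - h s))"
    and b: "\<And>t. s \<le> t \<Longrightarrow> t \<le> T \<Longrightarrow>
      l1 (U t T *v (Y T *v \<eta>)) \<le> N * b * exp (- \<beta> * (h T - h t))"
  shows "l1 (Y t *v \<eta>) \<le> N / p * (a * exp (- \<gamma> * (h t - h s)) + b * exp (- \<gamma> * (h T - h t)))"
proof -
  define C where "C = N / p"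
  have C: "C * p = N" "0 \<le> C" using p_q N_ge_1 by (auto simp: C_def)
  define \<phi> where "\<phi> u = C * a * exp (- \<gamma> * (h u - h s)) + C * b * exp (- \<gamma> * (h T - h u))" for u
  define w where "w u = l1 (Y u *v \<eta>) - \<phi> u" for u
  have "continuous_on {s..T} w"
    unfolding w_def \<phi>_def using assms
    by (intro continuous_intros solution_cont_subset h_cont_subset)
  then obtain r where r: "s \<le> r" "r \<le> T" and w_le: "\<And>u. s \<le> u \<Longrightarrow> u \<le> T \<Longrightarrow> w u \<le> w r"
    using continuous_attains_sup[of "{s..T}" w] assms by auto
  define m where "m = max 0 (w r)"
  have l1_le: "l1 (Y u *v \<eta>) \<le> \<phi> u + m" if "s \<le> u" "u \<le> T" for u
    using w_le[OF that] by (simp add: w_def m_def)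
  define d where "d = N * \<epsilon>"
  define g where "g e u = d * e * (\<phi> u + m)" for e u :: real
  \<comment> \<open>\<open>G\<close> is, up to sign, an antiderivative of the decay kernel times
    \<open>\<phi> + m\<close>, with \<open>x = \<beta>\<close> for the stable and
    \<open>x = - \<beta>\<close> for the unstable part. The factors \<open>p\<close> and
    \<open>q\<close> change places between \<open>?G1\<close> and \<open>?G2\<close>:
    \<open>p\<close> goes with the rate \<open>\<beta> - \<gamma>\<close> and \<open>q\<close> with
    \<open>\<beta> + \<gamma>\<close>.\<close>
  define G where "G x c1 c2 u = exp (x * (h u - h r)) *
      (c1 * exp (- \<gamma> * (h u - h s)) + c2 * exp (- \<gamma> * (h T - h u)) + m * d / \<beta>)" for x c1 c2 u
  let ?G1 = "G \<beta> (p * C * a) (q * C * b)" and ?G2 = "G (- \<beta>) (q * C * a) (p * C * b)"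
  have dG: "(G x c1 c2 has_real_derivative k u * (exp (x * (h u - h r)) *
      ((x - \<gamma>) * c1 * exp (- \<gamma> * (h u - h s)) + (x + \<gamma>) * c2 * exp (- \<gamma> * (h T - h u))
        + x * (m * d / \<beta>)))) (at u)"
    if "0 < u" for u x c1 c2
  proof -
    have "((\<lambda>u. exp (x * (h u - h r))) has_real_derivative exp (x * (h u - h r)) * (x * k u)) (at u)"
      by (intro DERIV_fun_exp DERIV_cmult DERIV_cong[OF DERIV_diff[OF deriv_h[OF that] DERIV_const]]) simp
    moreover have "((\<lambda>u. exp (- \<gamma> * (h u - h s))) has_real_derivative
        exp (- \<gamma> * (h u - h s)) * (- \<gamma> * k u)) (at u)"
      by (intro DERIV_fun_exp DERIV_cmult DERIV_cong[OF DERIV_diff[OF deriv_h[OF that] DERIV_const]]) simp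
    moreover have "((\<lambda>u. exp (- \<gamma> * (h T - h u))) has_real_derivative
        exp (- \<gamma> * (h T - h u)) * (- \<gamma> * - k u)) (at u)"
      by (intro DERIV_fun_exp DERIV_cmult DERIV_cong[OF DERIV_diff[OF DERIV_const deriv_h[OF that]]]) simp
    ultimately show ?thesis
      unfolding G_def
      by (rule DERIV_cong[OF DERIV_mult[OF _ DERIV_add[OF DERIV_add[OF DERIV_cmult DERIV_cmult] DERIV_const]]])
         (simp add: algebra_simps)
  qed
  have cont_G: "continuous_on {v..w} (G x c1 c2)" if "0 \<le> v" for v w x c1 c2
    unfolding G_def using that by (intro continuous_intros h_cont_subset)
  have pq: "(\<beta> - \<gamma>) * (p * C * z) = d * C * z" "(\<beta> + \<gamma>) * (q * C * z) = d * C * z"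
    "(- \<beta> - \<gamma>) * (q * C * z) = - (d * C * z)" "(- \<beta> + \<gamma>) * (p * C * z) = - (d * C * z)" for z
    unfolding d_def using p_q_\<epsilon>[THEN arg_cong[where f = "\<lambda>w. w * C * z"]] by (simp_all add: algebra_simps)
  have 1: "l1 (S r r *v (Y r *v \<eta>)) \<le> l1 (S r s *v (Y s *v \<eta>)) + ?G1 r - ?G1 s"
  proof (rule l1_S_solution_le[OF _ _ cont_G])
    fix u assume u: "s < u" "u < r"
    have eq: "(\<beta> - \<gamma>) * (p * C * a) * exp (- \<gamma> * (h u - h s)) + (\<beta> + \<gamma>) * (q * C * b) * exp (- \<gamma> * (h T - h u))
        + \<beta> * (m * d / \<beta>) = d * (\<phi> u + m)"
      unfolding pq using \<beta>_pos by (simp add: \<phi>_def algebra_simps)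
    show "(?G1 has_real_derivative k u * g (exp (- \<beta> * (h r - h u))) u) (at u)"
      using dG[of u \<beta> "p * C * a" "q * C * b"] u assms unfolding eq
      by (simp add: g_def right_diff_distrib mult_ac)
    show "N * \<epsilon> * exp (- \<beta> * (h r - h u)) * l1 (Y u *v \<eta>) \<le> g (exp (- \<beta> * (h r - h u))) u"
      unfolding g_def d_def using u r N\<epsilon>_nonneg by (intro mult_left_mono l1_le) auto
  qed (use assms r in auto)
  have 2: "l1 (U r r *v (Y r *v \<eta>)) \<le> l1 (U r T *v (Y T *v \<eta>)) + ?G2 r - ?G2 T"
  proof (rule l1_U_solution_le[OF _ _ cont_G])
    fix u assume u: "r < u" "u < T"
    have eq: "(- \<beta> - \<gamma>) * (q * C * a) * exp (- \<gamma> * (h u - h s)) + (- \<beta> + \<gamma>) * (p * C * b) * exp (- \<gamma> * (h T - h u))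
        + - \<beta> * (m * d / \<beta>) = - (d * (\<phi> u + m))"
      unfolding pq using \<beta>_pos by (simp add: \<phi>_def algebra_simps)
    show "(?G2 has_real_derivative - (k u * g (exp (- \<beta> * (h u - h r))) u)) (at u)"
      using dG[of u "- \<beta>" "q * C * a" "p * C * b"] u assms r unfolding eq
      by (simp add: g_def mult_ac)
    show "N * \<epsilon> * exp (- \<beta> * (h u - h r)) * l1 (Y u *v \<eta>) \<le> g (exp (- \<beta> * (h u - h r))) u"
      unfolding g_def d_def using u r N\<epsilon>_nonneg by (intro mult_left_mono l1_le) auto
  qed (use assms r in auto)
  have md: "0 \<le> m * d / \<beta>"
    using N\<epsilon>_nonneg \<beta>_pos by (simp add: m_def d_def)
  have Cp: "p * C * a = N * a" "p * C * b = N * b" using C(1) by (simp_all add: mult_ac)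
  \<comment> \<open>Since \<open>C * p = N\<close>, the values of \<open>?G1\<close> at
    \<open>s\<close> and of \<open>?G2\<close> at \<open>T\<close> absorb the homogeneous terms with
    \<open>a\<close> and \<open>b\<close>. What remains at \<open>r\<close> is
    \<open>\<phi> r\<close> and the contribution of \<open>m\<close>.\<close>
  have "exp (\<beta> * (h s - h r)) * (N * a) \<le> ?G1 s"
    unfolding G_def Cp using C ab p_q md by (intro mult_left_mono) auto
  moreover have "exp (- \<beta> * (h T - h r)) * (N * b) \<le> ?G2 T"
    unfolding G_def Cp using C ab p_q md by (intro mult_left_mono) auto
  moreover have "?G1 r + ?G2 r = (p + q) * \<phi> r + 2 * (m * d / \<beta>)"
    by (simp add: G_def \<phi>_def algebra_simps)
  moreover have a': "l1 (S r s *v (Y s *v \<eta>)) \<le> N * a * exp (\<beta> * (h s - h r))"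
    using a[OF r] by (simp add: right_diff_distrib)
  ultimately have "l1 (Y r *v \<eta>) \<le> \<phi> r + 2 * (m * d / \<beta>)"
    using 1 2 a' b[OF r] l1_le_S_U[of r "Y r *v \<eta>"] r assms(1) p_q(1)
    by (simp add: mult.commute[of "exp _"])
  then have "w r \<le> 2 * (m * d / \<beta>)" by (simp add: w_def)
  moreover have "2 * (m * d / \<beta>) < m" if "0 < m"
  proof -
    have "2 * d < \<beta>" using N\<epsilon>_small(1) N\<epsilon>_nonneg by (simp add: d_def)
    then have "m * (2 * d) < m * \<beta>" using that by simp
    then show ?thesis using \<beta>_pos by (simp add: field_simps)
  qed
  moreover have "w r = m" if "0 < m" using that by (auto simp: m_def)
  ultimately have "m \<le> 0" by (smt (verit))
  then show ?thesis
    using l1_le[of t] assms by (simp add: \<phi>_def C_def algebra_simps)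
qed

section \<open>Decay backwards in time of solutions without stable part at time 0\<close>

lemma exp_h_tendsto_0: "0 < c \<Longrightarrow> ((\<lambda>T. exp (- c * (h T - x))) \<longlongrightarrow> 0) at_top"
proof -
  assume "0 < c"
  then have "filterlim (\<lambda>T. c * (- x + h T)) at_top at_top"
    by (intro filterlim_tendsto_pos_mult_at_top[OF tendsto_const]
        filterlim_tendsto_add_at_top[OF tendsto_const] h_at_top)
  then have "((\<lambda>T. exp (- (c * (- x + h T)))) \<longlongrightarrow> 0) at_top"
    by (intro filterlim_compose[OF exp_at_bot] filterlim_compose[OF filterlim_uminus_at_bot_at_top])
  then show ?thesis by simp
qed

lemma Y_0_vec [simp]: "Y 0 *v v = v"
  by (simp add: Y_0)

lemma \<gamma>_pos: "0 < \<gamma>"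
  using \<gamma>_bounds \<beta>_pos by simp

lemma N_p_pos: "0 < N / p"
  using N_ge_1 p_q by simp

lemma U_U: "0 \<le> r \<Longrightarrow> U t r *v (U r s *v v) = U t s *v v"
proof -
  assume "0 \<le> r"
  have *: "(mat 1 - P) ** (mat 1 - P) = mat 1 - P"
    by (simp add: matrix_eq matrix_vector_mul_assoc[symmetric] matrix_vector_mult_diff_rdistrib
        matrix_vector_mult_diff_distrib) (simp add: matrix_vector_mul_assoc P_proj)
  have "matrix_inv (X r) ** X r = mat 1"
    using \<open>0 \<le> r\<close> by (intro matrix_inv_left inv_X)
  then show ?thesis
    unfolding U_def matrix_vector_mul_assoc
    by (metis * matrix_mul_assoc matrix_mul_rid)
qed

text \<open>If the stable part vanishes at time 0, so does its homogeneous evolution. The comparison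
  bound on [0, T] then holds with \<open>a = 0\<close>, and only the term decaying backwards from
  \<open>T\<close> survives.\<close>

lemma unstable_solution_bound:
  assumes "S 0 0 *v \<eta> = 0" "0 \<le> t" "t \<le> T"
  shows "l1 (Y t *v \<eta>) \<le> N / p * exp (- \<gamma> * (h T - h t)) * l1 (Y T *v \<eta>)"
proof -
  have "l1 (Y t *v \<eta>) \<le> N / p * (0 * exp (- \<gamma> * (h t - h 0)) +
      l1 (Y T *v \<eta>) * exp (- \<gamma> * (h T - h t)))"
  proof (rule solution_bound)
    fix u assume "0 \<le> u" "u \<le> T"
    then show "l1 (U u T *v (Y T *v \<eta>)) \<le> N * l1 (Y T *v \<eta>) * exp (- \<beta> * (h T - h u))"
      using l1_U_le[of u T "Y T *v \<eta>"] by (simp add: mult_ac)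
    show "l1 (S u 0 *v (Y 0 *v \<eta>)) \<le> N * 0 * exp (- \<beta> * (h u - h 0))"
      using S_S[of 0 u 0 \<eta>] assms(1) by simp
  qed (use assms l1_nonneg in auto)
  then show ?thesis by (simp add: mult_ac)
qed

section \<open>Bounded solutions on the half-line\<close>

definition bounded_orbit :: "real ^ 'n \<Rightarrow> bool" where
  "bounded_orbit \<eta> \<longleftrightarrow> (\<exists>M. \<forall>t\<ge>0. l1 (Y t *v \<eta>) \<le> M)"

text \<open>Boundedness allows the comparison bound on [s, T] with the same \<open>b = M\<close> for
  every \<open>T\<close>; the term from the right end disappears as \<open>T\<close> tends to
  infinity. Taking \<open>a = 0\<close> later yields uniqueness of bounded solutions.\<close>

lemma bounded_orbit_bound:
  assumes "bounded_orbit \<eta>" "0 \<le> s" "s \<le> t" "0 \<le> a"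
    and a: "\<And>t. s \<le> t \<Longrightarrow> l1 (S t s *v (Y s *v \<eta>)) \<le> N * a * exp (- \<beta> * (h t - h s))"
  shows "l1 (Y t *v \<eta>) \<le> N / p * exp (- \<gamma> * (h t - h s)) * a"
proof -
  obtain M where M: "\<And>t. 0 \<le> t \<Longrightarrow> l1 (Y t *v \<eta>) \<le> M"
    using assms by (auto simp: bounded_orbit_def)
  have "l1 (Y t *v \<eta>) \<le> N / p * (a * exp (- \<gamma> * (h t - h s)) + M * exp (- \<gamma> * (h T - h t)))"
    if "t \<le> T" for T
  proof (rule solution_bound)
    fix u assume "s \<le> u" "u \<le> T"
    then have "l1 (U u T *v (Y T *v \<eta>)) \<le> N * exp (- \<beta> * (h T - h u)) * M"
      using assms N_ge_1 by (intro order_trans[OF l1_U_le] mult_left_mono M) auto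
    then show "l1 (U u T *v (Y T *v \<eta>)) \<le> N * M * exp (- \<beta> * (h T - h u))"
      by (simp add: mult_ac)
  next
    show "0 \<le> M" using M[of 0] l1_nonneg[of "Y 0 *v \<eta>"] by simp
  qed (use assms that in auto)
  then have "eventually (\<lambda>T. l1 (Y t *v \<eta>) \<le>
      N / p * (a * exp (- \<gamma> * (h t - h s)) + M * exp (- \<gamma> * (h T - h t)))) at_top"
    using eventually_ge_at_top[of t] by (rule eventually_mono[rotated])
  moreover have "((\<lambda>T. N / p * (a * exp (- \<gamma> * (h t - h s)) + M * exp (- \<gamma> * (h T - h t))))
      \<longlongrightarrow> N / p * (a * exp (- \<gamma> * (h t - h s)) + M * 0)) at_top"
    by (intro tendsto_intros exp_h_tendsto_0 \<gamma>_pos)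
  ultimately have "l1 (Y t *v \<eta>) \<le> N / p * (a * exp (- \<gamma> * (h t - h s)) + M * 0)"
    by (intro tendsto_lowerbound) auto
  then show ?thesis by (simp add: mult_ac)
qed

lemma stable_solution_bound:
  assumes "bounded_orbit \<eta>" "0 \<le> s" "s \<le> t"
  shows "l1 (Y t *v \<eta>) \<le> N / p * exp (- \<gamma> * (h t - h s)) * l1 (Y s *v \<eta>)"
proof (rule bounded_orbit_bound[OF assms l1_nonneg])
  fix t assume "s \<le> t"
  then show "l1 (S t s *v (Y s *v \<eta>)) \<le> N * l1 (Y s *v \<eta>) * exp (- \<beta> * (h t - h s))"
    using l1_S_le[of s t "Y s *v \<eta>"] assms by (simp add: mult_ac)
qed

lemma bounded_orbit_eq_0:
  assumes "bounded_orbit \<eta>" "S 0 0 *v \<eta> = 0"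
  shows "\<eta> = 0"
proof -
  have "l1 (Y 0 *v \<eta>) \<le> N / p * exp (- \<gamma> * (h 0 - h 0)) * 0"
  proof (rule bounded_orbit_bound[OF assms(1)])
    fix t :: real
    show "l1 (S t 0 *v (Y 0 *v \<eta>)) \<le> N * 0 * exp (- \<beta> * (h t - h 0))"
      using S_S[of 0 t 0 \<eta>] assms(2) by simp
  qed auto
  then show ?thesis using l1_nonneg[of \<eta>] l1_eq_0_iff[of \<eta>] by simp
qed

lemma bounded_orbit_add:
  assumes "bounded_orbit \<eta>" "bounded_orbit \<zeta>"
  shows "bounded_orbit (\<eta> + \<zeta>)"
proof -
  obtain M M' where "l1 (Y t *v \<eta>) \<le> M" "l1 (Y t *v \<zeta>) \<le> M'" if "0 \<le> t" for t
    using assms unfolding bounded_orbit_def by blast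
  then have "l1 (Y t *v (\<eta> + \<zeta>)) \<le> M + M'" if "0 \<le> t" for t
    unfolding matrix_vector_right_distrib using that
    by (intro order_trans[OF l1_triangle add_mono])
  then show ?thesis unfolding bounded_orbit_def by blast
qed

lemma bounded_orbit_scaleR:
  assumes "bounded_orbit \<eta>"
  shows "bounded_orbit (c *\<^sub>R \<eta>)"
proof -
  obtain M where M: "\<And>t. 0 \<le> t \<Longrightarrow> l1 (Y t *v \<eta>) \<le> M"
    using assms unfolding bounded_orbit_def by blast
  have "l1 (Y t *v (c *\<^sub>R \<eta>)) \<le> \<bar>c\<bar> * M" if "0 \<le> t" for t
    unfolding matrix_vector_mult_scaleR l1_scaleR using M[OF that] by (intro mult_left_mono) auto
  then show ?thesis unfolding bounded_orbit_def by blast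
qed

lemma bounded_orbit_unique:
  assumes "bounded_orbit \<eta>" "bounded_orbit \<zeta>" "S 0 0 *v \<eta> = S 0 0 *v \<zeta>"
  shows "\<eta> = \<zeta>"
proof -
  have "bounded_orbit (\<eta> + (- 1) *\<^sub>R \<zeta>)"
    by (intro bounded_orbit_add bounded_orbit_scaleR assms)
  then have "\<eta> + (- 1) *\<^sub>R \<zeta> = 0"
    by (rule bounded_orbit_eq_0)
       (simp only: matrix_vector_right_distrib matrix_vector_mult_scaleR assms(3), simp)
  then show ?thesis by simp
qed

section \<open>Construction of the perturbed projection\<close>

lemma ex_boundary_value_solution:
  assumes "0 \<le> T"
  obtains \<eta> where "S 0 0 *v \<eta> = S 0 0 *v \<xi>"
    and "\<And>t. 0 \<le> t \<Longrightarrow> t \<le> T \<Longrightarrow> l1 (Y t *v \<eta>) \<le> N / p * l1 \<xi>"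
proof -
  \<comment> \<open>\<open>L\<close> merges the two boundary conditions into one square system: its
    summands lie in complementary subspaces, so they can be recovered separately. The comparison
    bound with zero data makes \<open>L\<close> injective, hence surjective in finite
    dimension.\<close>
  define L where "L v = S 0 0 *v v + U 0 T *v (Y T *v v)" for v
  have S_L: "S 0 0 *v L v = S 0 0 *v v" for v
    using S_U[of 0 0 T "Y T *v v"] S_S[of 0 0 0 v] by (simp add: L_def matrix_vector_right_distrib)
  have bound: "l1 (Y t *v \<eta>) \<le> N / p * (l1 \<xi> * exp (- \<gamma> * (h t - h 0)) + 0 * exp (- \<gamma> * (h T - h t)))"
    if \<eta>: "S 0 0 *v \<eta> = S 0 0 *v \<xi>" "U 0 T *v (Y T *v \<eta>) = 0" and "0 \<le> t" "t \<le> T" for t \<eta> \<xi>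
  proof (rule solution_bound)
    fix u assume u: "0 \<le> u" "u \<le> T"
    have "S u 0 *v \<eta> = S u 0 *v \<xi>"
      using S_S[of 0 u 0 \<eta>] S_S[of 0 u 0 \<xi>] \<eta>(1) by simp
    then show "l1 (S u 0 *v (Y 0 *v \<eta>)) \<le> N * l1 \<xi> * exp (- \<beta> * (h u - h 0))"
      using l1_S_le[of 0 u \<xi>] u by (simp add: mult_ac)
    show "l1 (U u T *v (Y T *v \<eta>)) \<le> N * 0 * exp (- \<beta> * (h T - h u))"
      using U_U[of 0 u T "Y T *v \<eta>"] \<eta>(2) by simp
  qed (use that l1_nonneg in auto)
  have "linear L"
    unfolding L_def by (intro linear_compose_add) (auto simp: matrix_vector_mul_assoc)
  moreover have "inj L"
  proof (subst linear_injective_0[OF \<open>linear L\<close>], intro allI impI)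
    fix v assume v: "L v = 0"
    then have "S 0 0 *v v = 0" using S_L[of v] by simp
    with v have "U 0 T *v (Y T *v v) = 0" by (simp add: L_def)
    with bound[of v 0 0] \<open>S 0 0 *v v = 0\<close> assms show "v = 0"
      using l1_nonneg[of v] l1_eq_0_iff[of v] by simp
  qed
  ultimately have "surj L" by (rule eucl.linear_inj_imp_surj)
  then obtain \<eta> where \<eta>: "L \<eta> = S 0 0 *v \<xi>" by (metis surjD)
  then have 1: "S 0 0 *v \<eta> = S 0 0 *v \<xi>"
    using S_L[of \<eta>] S_S[of 0 0 0 \<xi>] by simp
  moreover have 2: "U 0 T *v (Y T *v \<eta>) = 0" using \<eta> 1 by (simp add: L_def)
  moreover have "l1 (Y t *v \<eta>) \<le> N / p * l1 \<xi>" if "0 \<le> t" "t \<le> T" for t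
  proof -
    have "l1 \<xi> * exp (- \<gamma> * (h t - h 0)) \<le> l1 \<xi> * 1"
      using h_mono[of 0 t] that \<gamma>_pos l1_nonneg by (intro mult_left_mono) auto
    then have "N / p * (l1 \<xi> * exp (- \<gamma> * (h t - h 0))) \<le> N / p * l1 \<xi>"
      using N_p_pos by (intro mult_left_mono) auto
    with bound[OF 1 2 that] show ?thesis by simp
  qed
  ultimately show thesis using that by blast
qed

text \<open>The bound \<open>N / p * l1 \<xi>\<close> does not depend on the interval, so the
  initial values have a convergent subsequence. Each fixed \<open>t\<close> lies in all but finitely
  many of the intervals [0, r n], and the bound passes to the limit.\<close>

lemma ex_bounded_orbit:
  obtains \<eta> where "S 0 0 *v \<eta> = S 0 0 *v \<xi>" "bounded_orbit \<eta>"
proof -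
  have "\<exists>\<eta>. S 0 0 *v \<eta> = S 0 0 *v \<xi> \<and>
      (\<forall>t. 0 \<le> t \<and> t \<le> real n \<longrightarrow> l1 (Y t *v \<eta>) \<le> N / p * l1 \<xi>)" for n
    using ex_boundary_value_solution[of "real n" \<xi>] by (metis of_nat_0_le_iff)
  then obtain f where f: "\<And>n. S 0 0 *v f n = S 0 0 *v \<xi>"
      "\<And>n t. 0 \<le> t \<Longrightarrow> t \<le> real n \<Longrightarrow> l1 (Y t *v f n) \<le> N / p * l1 \<xi>"
    by metis
  have "norm (f n) \<le> N / p * l1 \<xi>" for n
    using f(2)[of 0 n] norm_le_l1[of "f n"] by simp
  then have "bounded (range f)" by (auto simp: bounded_iff)
  then obtain \<eta> r where r: "strict_mono (r :: nat \<Rightarrow> nat)" and lim: "(f \<circ> r) \<longlonglongrightarrow> \<eta>"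
    using bounded_imp_convergent_subsequence by blast
  have lim': "(\<lambda>n. M *v f (r n)) \<longlonglongrightarrow> M *v \<eta>" for M :: "real ^ 'n ^ 'n"
    using bounded_linear.tendsto[OF matrix_vector_mul_bounded_linear lim] by (simp add: o_def)
  have "S 0 0 *v \<eta> = S 0 0 *v \<xi>"
    using lim'[of "S 0 0"] f(1) by (simp add: LIMSEQ_const_iff)
  moreover have "l1 (Y t *v \<eta>) \<le> N / p * l1 \<xi>" if "0 \<le> t" for t
  proof (rule tendsto_upperbound[OF tendsto_l1[OF lim']])
    have "t \<le> real (r n)" if "nat \<lceil>t\<rceil> \<le> n" for n
      using seq_suble[OF r, of n] that by linarith
    then show "\<forall>\<^sub>F n in sequentially. l1 (Y t *v f (r n)) \<le> N / p * l1 \<xi>"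
      unfolding eventually_sequentially using f(2) \<open>0 \<le> t\<close> by blast
  qed simp
  ultimately show thesis using that by (auto simp: bounded_orbit_def)
qed

text \<open>Uniqueness does all the work: sums, multiples and \<open>F \<xi>\<close> itself are
  bounded and have the required stable part, so \<open>F\<close> is linear and idempotent. The two
  mixed identities express that \<open>Q\<close> and \<open>S 0 0\<close> have the same kernel,
  whence equal ranks.\<close>

lemma ex_projection:
  obtains Q where "Q ** Q = Q" "S 0 0 ** Q = S 0 0" "Q ** S 0 0 = Q"
    "\<And>\<xi>. bounded_orbit (Q *v \<xi>)"
proof -
  have "\<exists>\<eta>. S 0 0 *v \<eta> = S 0 0 *v \<xi> \<and> bounded_orbit \<eta>" for \<xi>
    by (rule ex_bounded_orbit[of \<xi>]) blast
  then obtain F where F: "\<And>\<xi>. S 0 0 *v F \<xi> = S 0 0 *v \<xi>" "\<And>\<xi>. bounded_orbit (F \<xi>)"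
    by metis
  have "linear F"
    by (rule linearI; rule bounded_orbit_unique)
       (auto simp: F bounded_orbit_add bounded_orbit_scaleR matrix_vector_right_distrib matrix_vector_mult_scaleR)
  then have F_eq: "matrix F *v \<xi> = F \<xi>" for \<xi>
    by (rule matrix_works[OF linear_matrix_vector_mul_eq[THEN iffD2]])
  have "F (F \<xi>) = F \<xi>" "F (S 0 0 *v \<xi>) = F \<xi>" for \<xi>
    by (rule bounded_orbit_unique; simp add: F S_S)+
  then show thesis
    using that[of "matrix F"] F by (auto simp: matrix_eq matrix_vector_mul_assoc[symmetric] F_eq)
qed

section \<open>The small component of decaying and of growing solutions\<close>

lemma deriv_exp_h:
  assumes "0 < u"
  shows "((\<lambda>u. c * exp (x * (h u - r))) has_real_derivative k u * (c * x * exp (x * (h u - r)))) (at u)"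
proof -
  have "((\<lambda>u. x * (h u - r)) has_real_derivative x * k u) (at u)"
    by (intro DERIV_cmult DERIV_cong[OF DERIV_diff[OF deriv_h[OF assms] DERIV_const]]) simp
  from DERIV_cmult[OF DERIV_fun_exp[OF this], of c] show ?thesis by (simp add: mult_ac)
qed

lemma exp_\<beta>_\<gamma>: "c * exp (- \<beta> * x) * (exp (- \<gamma> * x) * K) = c * K * exp (- (\<beta> + \<gamma>) * x)"
proof -
  have "exp (- (\<beta> + \<gamma>) * x) = exp (- \<beta> * x) * exp (- \<gamma> * x)"
    unfolding exp_add[symmetric] by (simp add: algebra_simps)
  then show ?thesis by simp
qed

text \<open>The unstable part is fed only by the future of the solution. There the kernel and the
  solution decay together at rate \<open>\<beta> + \<gamma>\<close>, and integration gives
  \<open>N * \<epsilon> / (\<beta> + \<gamma>) = q\<close>; the term at \<open>T\<close> tends to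
  0.\<close>

lemma U_stable_solution_le:
  assumes "bounded_orbit \<eta>" "0 \<le> t"
  shows "l1 (U t t *v (Y t *v \<eta>)) \<le> N / p * q * l1 (Y t *v \<eta>)"
proof -
  obtain M where M: "\<And>t. 0 \<le> t \<Longrightarrow> l1 (Y t *v \<eta>) \<le> M"
    using assms by (auto simp: bounded_orbit_def)
  define K where "K = N / p * l1 (Y t *v \<eta>)"
  define G where "G u = K * q * exp (- (\<beta> + \<gamma>) * (h u - h t))" for u
  have K: "0 \<le> K" unfolding K_def using N_p_pos l1_nonneg by (intro mult_nonneg_nonneg) auto
  have "l1 (U t t *v (Y t *v \<eta>)) \<le> N * M * exp (- \<beta> * (h T - h t)) + K * q" if "t \<le> T" for T
  proof -
    have "l1 (U t t *v (Y t *v \<eta>)) \<le> l1 (U t T *v (Y T *v \<eta>)) + G t - G T"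
    proof (rule l1_U_solution_le[OF \<open>0 \<le> t\<close> \<open>t \<le> T\<close>])
      fix u assume u: "t < u" "u < T"
      have eq: "K * q * - (\<beta> + \<gamma>) = - (N * \<epsilon> * K)"
        unfolding p_q_\<epsilon>(2)[symmetric] by (simp add: algebra_simps)
      show "(G has_real_derivative - (k u * (N * \<epsilon> * K * exp (- (\<beta> + \<gamma>) * (h u - h t))))) (at u)"
        unfolding G_def using deriv_exp_h[of u "K * q" "- (\<beta> + \<gamma>)" "h t"] u assms unfolding eq by simp
      have "N * \<epsilon> * exp (- \<beta> * (h u - h t)) * l1 (Y u *v \<eta>) \<le>
          N * \<epsilon> * exp (- \<beta> * (h u - h t)) * (exp (- \<gamma> * (h u - h t)) * K)"
        using stable_solution_bound[OF assms, of u] u N\<epsilon>_nonneg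
        by (intro mult_left_mono mult_nonneg_nonneg[OF N\<epsilon>_nonneg]) (auto simp: K_def mult_ac)
      also have "\<dots> = N * \<epsilon> * K * exp (- (\<beta> + \<gamma>) * (h u - h t))"
        by (rule exp_\<beta>_\<gamma>)
      finally show "N * \<epsilon> * exp (- \<beta> * (h u - h t)) * l1 (Y u *v \<eta>) \<le>
          N * \<epsilon> * K * exp (- (\<beta> + \<gamma>) * (h u - h t))" .
    qed (unfold G_def, intro continuous_intros h_cont_subset assms)
    moreover have "l1 (U t T *v (Y T *v \<eta>)) \<le> N * exp (- \<beta> * (h T - h t)) * M"
      using assms that N_ge_1 by (intro order_trans[OF l1_U_le] mult_left_mono M) auto
    moreover have "0 \<le> G T" using K p_q by (simp add: G_def)
    ultimately show ?thesis by (simp add: G_def mult_ac)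
  qed
  then have "eventually (\<lambda>T. l1 (U t t *v (Y t *v \<eta>)) \<le> N * M * exp (- \<beta> * (h T - h t)) + K * q) at_top"
    using eventually_ge_at_top[of t] by (rule eventually_mono[rotated])
  moreover have "((\<lambda>T. N * M * exp (- \<beta> * (h T - h t)) + K * q) \<longlongrightarrow> N * M * 0 + K * q) at_top"
    by (intro tendsto_intros exp_h_tendsto_0 \<beta>_pos)
  ultimately have "l1 (U t t *v (Y t *v \<eta>)) \<le> N * M * 0 + K * q"
    by (intro tendsto_lowerbound) auto
  then show ?thesis by (simp add: K_def mult_ac)
qed

text \<open>The same computation into the past. No limit is taken, as the homogeneous term from time
  0 is exactly zero.\<close>

lemma S_unstable_solution_le:
  assumes "S 0 0 *v \<eta> = 0" "0 \<le> t"
  shows "l1 (S t t *v (Y t *v \<eta>)) \<le> N / p * q * l1 (Y t *v \<eta>)"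
proof -
  define K where "K = N / p * l1 (Y t *v \<eta>)"
  define G where "G u = K * q * exp ((\<beta> + \<gamma>) * (h u - h t))" for u
  have K: "0 \<le> K" unfolding K_def using N_p_pos l1_nonneg by (intro mult_nonneg_nonneg) auto
  have "l1 (S t t *v (Y t *v \<eta>)) \<le> l1 (S t 0 *v (Y 0 *v \<eta>)) + G t - G 0"
  proof (rule l1_S_solution_le[OF order_refl \<open>0 \<le> t\<close>])
    fix u assume u: "0 < u" "u < t"
    have eq: "K * q * (\<beta> + \<gamma>) = N * \<epsilon> * K"
      unfolding p_q_\<epsilon>(2)[symmetric] by (simp add: mult_ac)
    show "(G has_real_derivative k u * (N * \<epsilon> * K * exp ((\<beta> + \<gamma>) * (h u - h t)))) (at u)"
      unfolding G_def using deriv_exp_h[of u "K * q" "\<beta> + \<gamma>" "h t"] u unfolding eq by simp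
    have "N * \<epsilon> * exp (- \<beta> * (h t - h u)) * l1 (Y u *v \<eta>) \<le>
        N * \<epsilon> * exp (- \<beta> * (h t - h u)) * (exp (- \<gamma> * (h t - h u)) * K)"
      using unstable_solution_bound[OF assms(1), of u t] u N\<epsilon>_nonneg
      by (intro mult_left_mono mult_nonneg_nonneg[OF N\<epsilon>_nonneg]) (auto simp: K_def mult_ac)
    also have "\<dots> = N * \<epsilon> * K * exp ((\<beta> + \<gamma>) * (h u - h t))"
      unfolding exp_\<beta>_\<gamma> by (simp add: algebra_simps)
    finally show "N * \<epsilon> * exp (- \<beta> * (h t - h u)) * l1 (Y u *v \<eta>) \<le>
        N * \<epsilon> * K * exp ((\<beta> + \<gamma>) * (h u - h t))" .
  qed (unfold G_def, intro continuous_intros h_cont_subset order_refl)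
  moreover have "S t 0 *v (Y 0 *v \<eta>) = 0"
    using S_S[of 0 t 0 \<eta>] assms(1) by simp
  moreover have "0 \<le> G 0" using K p_q by (simp add: G_def)
  ultimately show ?thesis by (simp add: G_def K_def mult_ac)
qed

text \<open>\<open>X 0\<close> may differ from the identity, so \<open>S 0 0\<close> is a conjugate
  of \<open>P\<close> rather than \<open>P\<close> itself.\<close>

lemma rank_S: "rank (S 0 0) = rank P"
proof (rule antisym)
  show "rank (S 0 0) \<le> rank P"
    unfolding S_def by (rule order_trans[OF rank_mul_le_left rank_mul_le_right])
  have "matrix_inv (X 0) ** S 0 0 ** X 0 = (matrix_inv (X 0) ** X 0) ** P ** (matrix_inv (X 0) ** X 0)"
    by (simp add: S_def matrix_mul_assoc)
  then have "P = matrix_inv (X 0) ** S 0 0 ** X 0"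
    by (simp add: matrix_inv_left[OF inv_X])
  then show "rank P \<le> rank (S 0 0)"
    by (metis order_trans rank_mul_le_left rank_mul_le_right)
qed

text \<open>With N \<epsilon> = 2 \<beta> p q the first inequality reduces to 1 - 5 p q \<le> p^2.
  Since 1 - p^2 = q (1 + p), this follows from 1 + p \<le> 5 p. The second then uses 5 N \<epsilon>
  < \<beta> and 5 N^2 \<epsilon> < \<beta>.\<close>

lemma projection_constant_le:
  "N / p * q * (2 * \<beta> - 5 * (N * \<epsilon>)) \<le> N * (N * \<epsilon>)" "N / p * q \<le> 1 / 5"
proof -
  have p: "0 < p" using p_q by simp
  have x: "N * \<epsilon> = 2 * \<beta> * p * q"
    using p_q(2) p_q_\<epsilon>(2) by (simp add: mult_ac)
  have "q * (1 + p) \<le> q * (5 * p)"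
    using p_q by (intro mult_left_mono) auto
  moreover have "q * (1 + p) = 1 - p * p"
  proof -
    have q: "q = 1 - p" using p_q(1) by simp
    show ?thesis unfolding q by (simp add: algebra_simps)
  qed
  ultimately have "1 - 5 * p * q \<le> p * p" by (simp add: mult_ac)
  then have "2 * \<beta> * N * q / p * (1 - 5 * p * q) \<le> 2 * \<beta> * N * q / p * (p * p)"
    using p_q N_ge_1 \<beta>_pos p by (intro mult_left_mono) auto
  then show 1: "N / p * q * (2 * \<beta> - 5 * (N * \<epsilon>)) \<le> N * (N * \<epsilon>)"
    unfolding x using p by (simp add: field_simps)
  have "N / p * q * \<beta> \<le> N / p * q * (2 * \<beta> - 5 * (N * \<epsilon>))"
    using N\<epsilon>_small(1) N_p_pos p_q(5) by (intro mult_left_mono mult_nonneg_nonneg) auto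
  also note 1
  also have "N * (N * \<epsilon>) \<le> 1 / 5 * \<beta>" using N\<epsilon>_small(2) by simp
  finally show "N / p * q \<le> 1 / 5" using \<beta>_pos by (simp only: mult_le_cancel_right_pos)
qed

theorem ex_perturbed_projection:
  obtains Q where "Q ** Q = Q" "rank Q = rank P"
    and "\<And>t s. 0 \<le> s \<Longrightarrow> s \<le> t \<Longrightarrow> colsum_norm (Y t ** Q ** matrix_inv (Y s))
      \<le> 25 * N\<^sup>2 / 9 * exp (- (\<beta> - 3 * \<epsilon> * N) * (h t - h s))"
    and "\<And>t s. 0 \<le> t \<Longrightarrow> t \<le> s \<Longrightarrow> colsum_norm (Y t ** (mat 1 - Q) ** matrix_inv (Y s))
      \<le> 25 * N\<^sup>2 / 9 * exp (- (\<beta> - 3 * \<epsilon> * N) * (h s - h t))"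
    and "\<And>t. 0 \<le> t \<Longrightarrow>
      colsum_norm (Y t ** Q ** matrix_inv (Y t) - X t ** P ** matrix_inv (X t))
      \<le> 2 * \<epsilon> * N ^ 3 / (2 * \<beta> - 5 * \<epsilon> * N - 2 * \<epsilon> * N\<^sup>2)"
proof -
  obtain Q where Q: "Q ** Q = Q" "S 0 0 ** Q = S 0 0" "Q ** S 0 0 = Q"
    and bounded: "\<And>\<xi>. bounded_orbit (Q *v \<xi>)"
    by (rule ex_projection) blast
  have "rank Q = rank (S 0 0)"
    using rank_mul_le_left[of "S 0 0" Q] rank_mul_le_right[of "S 0 0" Q] Q
      rank_mul_le_left[of Q "S 0 0"] rank_mul_le_right[of Q "S 0 0"] by simp
  then have rank: "rank Q = rank P" by (simp add: rank_S)
  have kernel: "S 0 0 *v (w - Q *v w) = 0" for w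
    by (simp add: matrix_vector_mult_diff_distrib matrix_vector_mul_assoc Q)
  define D where "D s = Y s ** Q ** matrix_inv (Y s) - S s s" for s
  define d where "d s = colsum_norm (D s)" for s
  define \<eta> where "\<eta> = N / p * q"
  have \<eta>: "0 \<le> \<eta>" "\<eta> \<le> 1 / 5" "\<eta> * (2 * \<beta> - 5 * (N * \<epsilon>)) \<le> N * (N * \<epsilon>)"
    using projection_constant_le N_p_pos p_q(5) unfolding \<eta>_def
    by (auto intro: mult_nonneg_nonneg simp del: times_divide_eq_left)
  have Y_inv: "Y s *v (matrix_inv (Y s) *v \<xi>) = \<xi>" if "0 \<le> s" for s \<xi>
    using matrix_inv_right[OF inv_Y[OF that]] by (simp add: matrix_vector_mul_assoc)
  have l1_parts: "l1 (Y s *v (Q *v w)) \<le> (N + d s) * l1 (Y s *v w)"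
    "l1 (Y s *v (w - Q *v w)) \<le> (N + d s) * l1 (Y s *v w)" if "0 \<le> s" for s w
  proof -
    have "matrix_inv (Y s) *v (Y s *v w) = w"
      by (simp add: matrix_vector_mul_assoc matrix_inv_left[OF inv_Y[OF that]])
    then have D: "D s *v (Y s *v w) = Y s *v (Q *v w) - S s s *v (Y s *v w)"
      by (simp add: D_def matrix_vector_mult_diff_rdistrib matrix_vector_mul_assoc[symmetric])
    have U: "U s s *v (Y s *v w) = Y s *v w - S s s *v (Y s *v w)"
      using S_plus_U[OF that, of "Y s *v w"] by (metis add_diff_cancel_left')
    have eq: "Y s *v (Q *v w) = S s s *v (Y s *v w) + D s *v (Y s *v w)"
      "Y s *v (w - Q *v w) = U s s *v (Y s *v w) - D s *v (Y s *v w)"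
      by (simp_all add: D U matrix_vector_mult_diff_distrib)
    have "l1 (S s s *v (Y s *v w)) \<le> N * l1 (Y s *v w)" "l1 (U s s *v (Y s *v w)) \<le> N * l1 (Y s *v w)"
      using l1_S_le[of s s "Y s *v w"] l1_U_le[of s s "Y s *v w"] that by simp_all
    moreover have "l1 (D s *v (Y s *v w)) \<le> d s * l1 (Y s *v w)"
      unfolding d_def by (rule l1_mult_vec_le)
    ultimately show "l1 (Y s *v (Q *v w)) \<le> (N + d s) * l1 (Y s *v w)"
      "l1 (Y s *v (w - Q *v w)) \<le> (N + d s) * l1 (Y s *v w)"
      unfolding eq distrib_right
      by (meson add_mono l1_triangle l1_triangle_diff order_trans)+
  qed
  \<comment> \<open>The norms of Q(s) = \<open>S s s + D s\<close> and of its complement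
    \<open>U s s - D s\<close> are at most \<open>N + d s\<close>, and each contributes one factor
    \<open>\<eta>\<close>. As \<open>d s\<close> is a finite number, it can afterwards be moved to
    the left-hand side.\<close>
  have d_le: "d s \<le> 2 * \<eta> * (N + d s)" if s: "0 \<le> s" for s
    unfolding d_def
  proof (rule colsum_norm_leI, fold d_def)
    fix \<xi>
    define w where "w = matrix_inv (Y s) *v \<xi>"
    have \<xi>: "Y s *v w = \<xi>" by (simp add: w_def Y_inv s)
    \<comment> \<open>Split \<xi> by Q(s). On the range of Q(s) the operator \<open>D s\<close> acts
      as the identity minus \<open>S s s\<close>, that is as \<open>U s s\<close>; on the kernel it
      acts as \<open>- S s s\<close>. Only the two small components occur.\<close>
    have "D s *v \<xi> = Y s *v (Q *v w) - S s s *v (Y s *v (Q *v w)) - S s s *v (Y s *v (w - Q *v w))"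
      unfolding matrix_vector_mult_diff_distrib \<xi>
      by (simp add: D_def w_def matrix_vector_mult_diff_rdistrib matrix_vector_mul_assoc matrix_mul_assoc)
    also have "\<dots> = U s s *v (Y s *v (Q *v w)) - S s s *v (Y s *v (w - Q *v w))"
      using S_plus_U[OF s, of "Y s *v (Q *v w)"] by (metis add_diff_cancel_left')
    finally have D\<xi>: "D s *v \<xi> = U s s *v (Y s *v (Q *v w)) - S s s *v (Y s *v (w - Q *v w))" .
    have "l1 (D s *v \<xi>) \<le> \<eta> * l1 (Y s *v (Q *v w)) + \<eta> * l1 (Y s *v (w - Q *v w))"
      unfolding D\<xi> \<eta>_def
      by (intro order_trans[OF l1_triangle_diff] add_mono
          U_stable_solution_le S_unstable_solution_le bounded kernel s)
    also have "\<dots> \<le> \<eta> * ((N + d s) * l1 \<xi>) + \<eta> * ((N + d s) * l1 \<xi>)"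
      using l1_parts[OF s, of w] \<eta>(1) unfolding \<xi> by (intro add_mono mult_left_mono)
    finally show "l1 (D s *v \<xi>) \<le> 2 * \<eta> * (N + d s) * l1 \<xi>"
      by (simp add: mult_ac)
  qed
  have d_nonneg: "0 \<le> d s" for s by (simp add: d_def colsum_norm_nonneg)
  \<comment> \<open>As \<open>2 * \<eta>\<close> is at most 2/5, 3/5 of \<open>N + d s\<close> is at
    most \<open>N\<close>. This is the second factor 5/3.\<close>
  have d_bound: "N + d s \<le> 5 / 3 * N" if "0 \<le> s" for s
  proof -
    have "2 * \<eta> * (N + d s) \<le> 2 / 5 * (N + d s)"
      using \<eta> d_nonneg[of s] N_ge_1 by (intro mult_right_mono) auto
    then show ?thesis using d_le[OF that] by simp
  qed
  have N_p: "N / p \<le> 5 / 3 * N"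
    using p_q N_ge_1 by (simp add: field_simps)
  have weight: "N / p * exp (- \<gamma> * r) * ((N + d s) * x)
      \<le> 25 * N\<^sup>2 / 9 * exp (- (\<beta> - 3 * \<epsilon> * N) * r) * x" if "0 \<le> r" "0 \<le> x" "0 \<le> s" for r s x
  proof -
    have "- \<gamma> * r \<le> - (\<beta> - 3 * \<epsilon> * N) * r"
      using \<gamma>_ge that by (intro mult_right_mono) auto
    then have "N / p * exp (- \<gamma> * r) * ((N + d s) * x) \<le>
        5 / 3 * N * exp (- (\<beta> - 3 * \<epsilon> * N) * r) * (5 / 3 * N * x)"
      using N_p d_bound[OF that(3)] that N_ge_1 d_nonneg[of s] N_p_pos
      by (intro mult_mono) auto
    then show ?thesis by (simp add: power2_eq_square mult_ac)
  qed
  have "colsum_norm (Y t ** Q ** matrix_inv (Y s))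
      \<le> 25 * N\<^sup>2 / 9 * exp (- (\<beta> - 3 * \<epsilon> * N) * (h t - h s))" if "0 \<le> s" "s \<le> t" for t s
  proof (rule colsum_norm_leI)
    fix \<xi>
    define w where "w = matrix_inv (Y s) *v \<xi>"
    have "l1 (Y t *v (Q *v w)) \<le> N / p * exp (- \<gamma> * (h t - h s)) * l1 (Y s *v (Q *v w))"
      by (rule stable_solution_bound[OF bounded that])
    also have "\<dots> \<le> N / p * exp (- \<gamma> * (h t - h s)) * ((N + d s) * l1 (Y s *v w))"
      using N_p_pos that by (intro mult_left_mono l1_parts mult_nonneg_nonneg) auto
    also have "\<dots> \<le> 25 * N\<^sup>2 / 9 * exp (- (\<beta> - 3 * \<epsilon> * N) * (h t - h s)) * l1 (Y s *v w)"
      using h_mono[OF that] that l1_nonneg by (intro weight) auto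
    finally show "l1 (Y t ** Q ** matrix_inv (Y s) *v \<xi>) \<le>
        25 * N\<^sup>2 / 9 * exp (- (\<beta> - 3 * \<epsilon> * N) * (h t - h s)) * l1 \<xi>"
      using Y_inv[of s \<xi>] that by (simp add: w_def matrix_vector_mul_assoc[symmetric])
  qed
  moreover have "colsum_norm (Y t ** (mat 1 - Q) ** matrix_inv (Y s))
      \<le> 25 * N\<^sup>2 / 9 * exp (- (\<beta> - 3 * \<epsilon> * N) * (h s - h t))" if "0 \<le> t" "t \<le> s" for t s
  proof (rule colsum_norm_leI)
    fix \<xi>
    define w where "w = matrix_inv (Y s) *v \<xi>"
    have s: "0 \<le> s" using that by simp
    have "l1 (Y t *v (w - Q *v w)) \<le> N / p * exp (- \<gamma> * (h s - h t)) * l1 (Y s *v (w - Q *v w))"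
      by (rule unstable_solution_bound[OF kernel that])
    also have "\<dots> \<le> N / p * exp (- \<gamma> * (h s - h t)) * ((N + d s) * l1 (Y s *v w))"
      using N_p_pos s by (intro mult_left_mono l1_parts mult_nonneg_nonneg) auto
    also have "\<dots> \<le> 25 * N\<^sup>2 / 9 * exp (- (\<beta> - 3 * \<epsilon> * N) * (h s - h t)) * l1 (Y s *v w)"
      using h_mono[OF that] s l1_nonneg by (intro weight) auto
    finally show "l1 (Y t ** (mat 1 - Q) ** matrix_inv (Y s) *v \<xi>) \<le>
        25 * N\<^sup>2 / 9 * exp (- (\<beta> - 3 * \<epsilon> * N) * (h s - h t)) * l1 \<xi>"
      using Y_inv[OF s, of \<xi>]
      by (simp add: w_def matrix_vector_mul_assoc[symmetric] matrix_vector_mult_diff_rdistrib)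
  qed
  moreover have "colsum_norm (Y s ** Q ** matrix_inv (Y s) - X s ** P ** matrix_inv (X s))
      \<le> 2 * \<epsilon> * N ^ 3 / (2 * \<beta> - 5 * \<epsilon> * N - 2 * \<epsilon> * N\<^sup>2)" if s: "0 \<le> s" for s
  proof -
    \<comment> \<open>Here the sharper bound
      \<open>\<eta> * \<kappa> \<le> N * (N * \<epsilon>)\<close> replaces
      \<open>\<eta> \<le> 1 / 5\<close>. Moving the term
      \<open>2 * \<epsilon> * N\<^sup>2 * d s\<close> to the left produces the stated denominator,
      which exceeds 3/5 \<beta>.\<close>
    define \<kappa> where "\<kappa> = 2 * \<beta> - 5 * (N * \<epsilon>)"
    have "0 \<le> \<kappa>" using N\<epsilon>_small(1) \<beta>_pos by (simp add: \<kappa>_def)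
    then have "d s * \<kappa> \<le> 2 * \<eta> * (N + d s) * \<kappa>"
      using d_le[OF s] by (intro mult_right_mono)
    also have "\<dots> = 2 * (N + d s) * (\<eta> * \<kappa>)" by simp
    also have "\<dots> \<le> 2 * (N + d s) * (N * (N * \<epsilon>))"
      using \<eta>(3) d_nonneg[of s] N_ge_1 unfolding \<kappa>_def by (intro mult_left_mono) auto
    finally have "d s * (2 * \<beta> - 5 * \<epsilon> * N - 2 * \<epsilon> * N\<^sup>2) \<le> 2 * \<epsilon> * N ^ 3"
      by (simp add: \<kappa>_def algebra_simps power2_eq_square power3_eq_cube)
    moreover have "0 < 2 * \<beta> - 5 * \<epsilon> * N - 2 * \<epsilon> * N\<^sup>2"
      using N\<epsilon>_small N\<epsilon>_nonneg \<beta>_pos by (simp add: algebra_simps power2_eq_square)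
    ultimately show ?thesis
      unfolding S_def[symmetric] D_def[symmetric] d_def[symmetric] by (simp add: pos_le_divide_eq)
  qed
  ultimately show thesis using that[OF Q(1) rank] by blast
qed

end

section \<open>Conformable equations\<close>

text \<open>For fixed t the conformable quotient is the ordinary difference quotient at 0 of g(t + e
  c) in e, where c = |t|^(1 - \<alpha>). Undoing this affine substitution by the chain rule divides
  by c.\<close>

lemma conformable_imp_has_vector_derivative:
  assumes "t \<noteq> 0" "has_conformable_derivative \<alpha> g D t"
  shows "(g has_vector_derivative \<bar>t\<bar> powr (\<alpha> - 1) *\<^sub>R D) (at t)"
proof -
  define c where "c = \<bar>t\<bar> powr (1 - \<alpha>)"
  have c: "0 < c" "1 / c = \<bar>t\<bar> powr (\<alpha> - 1)"
    using assms(1) powr_minus_divide[of "\<bar>t\<bar>" "1 - \<alpha>"] by (simp_all add: c_def)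
  define f where "f e = g (t + e * c)" for e
  have "((\<lambda>e. (f e - f 0) /\<^sub>R e) \<longlongrightarrow> D) (at 0)"
    using assms by (simp add: has_conformable_derivative_def has_conformable_derivative_nonzero_def f_def c_def)
  then have "((\<lambda>e. norm ((f e - f 0) /\<^sub>R e - D)) \<longlongrightarrow> 0) (at 0)"
    by (intro tendsto_norm_zero) (simp add: LIM_zero_iff)
  moreover have "norm ((f e - f 0) /\<^sub>R e - D) = norm (f (0 + e) - f 0 - e *\<^sub>R D) / norm e"
    if "e \<noteq> 0" for e
  proof -
    have "(f e - f 0) /\<^sub>R e - D = (f (0 + e) - f 0 - e *\<^sub>R D) /\<^sub>R e"
      using that by (simp add: scaleR_diff_right)
    then show ?thesis by (simp add: divide_inverse mult.commute)
  qed
  ultimately have "((\<lambda>e. norm (f (0 + e) - f 0 - e *\<^sub>R D) / norm e) \<longlongrightarrow> 0) (at 0)"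
    by (simp cong: LIM_cong)
  then have f: "(f has_vector_derivative D) (at 0)"
    unfolding has_vector_derivative_def has_derivative_at
    by (simp add: bounded_linear_scaleR_left)
  have "((\<lambda>s. (s - t) / c) has_vector_derivative 1 / c) (at t)"
    unfolding has_real_derivative_iff_has_vector_derivative[symmetric]
    using c by (auto intro!: derivative_eq_intros)
  from vector_diff_chain_at[OF this, of f D] f
  have "(f \<circ> (\<lambda>s. (s - t) / c) has_vector_derivative (1 / c) *\<^sub>R D) (at t)"
    by simp
  moreover have "f \<circ> (\<lambda>s. (s - t) / c) = g"
    using c by (auto simp: f_def)
  ultimately show ?thesis by (simp only: c(2))
qed

text \<open>Solutions are given column by column. Writing a matrix as a finite sum of linearly
  embedded columns transfers continuity and derivatives to matrix functions.\<close>

lemma matrix_eq_sum_columns: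
  fixes M :: "real ^ 'n ^ 'n"
  shows "M = (\<Sum>j\<in>UNIV. \<chi> i k. if k = j then column j M $ i else 0)"
  by (simp add: vec_eq_iff column_def)

lemma bounded_linear_column_embedding:
  "bounded_linear (\<lambda>v :: real ^ 'n. (\<chi> i k. if k = j then v $ i else 0) :: real ^ 'n ^ 'n)"
  unfolding linear_conv_bounded_linear[symmetric]
  by (rule linearI) (auto simp: vec_eq_iff)

lemma continuous_on_columns:
  fixes X :: "'a::topological_space \<Rightarrow> real ^ 'n ^ 'n"
  assumes "\<And>j. continuous_on T (\<lambda>t. column j (X t))"
  shows "continuous_on T X"
proof -
  have "continuous_on T (\<lambda>t. \<Sum>j\<in>UNIV. \<chi> i k. if k = j then column j (X t) $ i else 0)"
    by (intro continuous_on_sum bounded_linear.continuous_on[OF bounded_linear_column_embedding] assms)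
  then show ?thesis by (subst (asm) matrix_eq_sum_columns[symmetric])
qed

lemma has_vector_derivative_columns:
  fixes X :: "real \<Rightarrow> real ^ 'n ^ 'n"
  assumes "\<And>j. ((\<lambda>t. column j (X t)) has_vector_derivative column j D) F"
  shows "(X has_vector_derivative D) F"
proof -
  have "((\<lambda>t. \<Sum>j\<in>UNIV. \<chi> i k. if k = j then column j (X t) $ i else 0) has_vector_derivative
      (\<Sum>j\<in>UNIV. \<chi> i k. if k = j then column j D $ i else 0)) F"
    by (intro has_vector_derivative_sum
        bounded_linear.has_vector_derivative[OF bounded_linear_column_embedding] assms)
  then show ?thesis unfolding matrix_eq_sum_columns[symmetric] .
qed

lemma time_change_powr:
  assumes "0 < \<alpha>"
  shows "time_change (\<lambda>t. t powr \<alpha> / \<alpha>) (\<lambda>t. \<bar>t\<bar> powr (\<alpha> - 1))"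
proof
  show "continuous_on {0..} (\<lambda>t. t powr \<alpha> / \<alpha>)"
    using assms by (intro continuous_intros continuous_on_powr') auto
  show "((\<lambda>t. t powr \<alpha> / \<alpha>) has_real_derivative \<bar>t\<bar> powr (\<alpha> - 1)) (at t)" if "0 < t" for t
    using DERIV_cdivide[OF has_real_derivative_powr[OF that, of \<alpha>], of \<alpha>] assms that by simp
  have "filterlim (\<lambda>t :: real. exp (\<alpha> * ln t)) at_top at_top"
    using assms
    by (intro filterlim_compose[OF exp_at_top]
        filterlim_tendsto_pos_mult_at_top[OF tendsto_const] ln_at_top)
  then have "filterlim (\<lambda>t. t powr \<alpha>) at_top at_top"
    by (rule filterlim_mono_eventually)
       (auto simp: powr_def intro!: eventually_mono[OF eventually_gt_at_top[of 0]])
  then have "filterlim (\<lambda>t. inverse \<alpha> * t powr \<alpha>) at_top at_top"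
    using assms by (intro filterlim_tendsto_pos_mult_at_top[OF tendsto_const]) auto
  then show "filterlim (\<lambda>t. t powr \<alpha> / \<alpha>) at_top at_top"
    by (simp add: divide_inverse mult.commute)
qed simp

lemma fundamental_matrix_continuous:
  "fundamental_matrix \<alpha> A X \<Longrightarrow> continuous_on T X"
  by (rule continuous_on_columns)
     (auto simp: fundamental_matrix_def conformable_solution_def intro: continuous_on_subset)

lemma fundamental_matrix_deriv:
  assumes "fundamental_matrix \<alpha> A X" "t \<noteq> 0"
  shows "(X has_vector_derivative \<bar>t\<bar> powr (\<alpha> - 1) *\<^sub>R (A t ** X t)) (at t)"
proof (rule has_vector_derivative_columns)
  fix j
  have "has_conformable_derivative \<alpha> (\<lambda>t. column j (X t)) (A t *v column j (X t)) t"
    using assms by (simp add: fundamental_matrix_def conformable_solution_def)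
  then have "((\<lambda>t. column j (X t)) has_vector_derivative
      \<bar>t\<bar> powr (\<alpha> - 1) *\<^sub>R (A t *v column j (X t))) (at t)"
    by (rule conformable_imp_has_vector_derivative[OF assms(2)])
  moreover have "column j (\<bar>t\<bar> powr (\<alpha> - 1) *\<^sub>R (A t ** X t)) =
      \<bar>t\<bar> powr (\<alpha> - 1) *\<^sub>R (A t *v column j (X t))"
    by (simp add: vec_eq_iff column_def matrix_matrix_mult_def matrix_vector_mult_def)
  ultimately show "((\<lambda>t. column j (X t)) has_vector_derivative
      column j (\<bar>t\<bar> powr (\<alpha> - 1) *\<^sub>R (A t ** X t))) (at t)"
    by simp
qed

text \<open>Linear independence is only assumed on the whole real line, so a solution vanishing at some
  \<open>t \<ge> 0\<close> has to be shown to vanish on both half-lines; the negative one is reflected.\<close>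

lemma fundamental_matrix_invertible:
  fixes A X :: "real \<Rightarrow> real ^ 'n ^ 'n"
  assumes "0 < \<alpha>" and A: "continuous_on UNIV A" and X: "fundamental_matrix \<alpha> A X" and "0 \<le> t"
  shows "invertible (X t)"
proof -
  interpret time_change "\<lambda>t. t powr \<alpha> / \<alpha>" "\<lambda>t. \<bar>t\<bar> powr (\<alpha> - 1)"
    by (rule time_change_powr) fact
  have "c = 0" if c: "X t *v c = 0" for c
  proof -
    define x where "x s = X s *v c" for s
    have cont: "continuous_on T x" for T
      unfolding x_def by (intro continuous_intros fundamental_matrix_continuous[OF X])
    have deriv: "(x has_vector_derivative \<bar>s\<bar> powr (\<alpha> - 1) *\<^sub>R (A s *v x s)) (at s)" if "s \<noteq> 0" for s
      unfolding x_def
      using bounded_linear.has_vector_derivative[OF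
          bounded_bilinear.bounded_linear_left[OF bounded_bilinear_matrix_vector_mult]
          fundamental_matrix_deriv[OF X that], of c]
      by (simp add: scaleR_matrix_vector_assoc[symmetric] matrix_vector_mul_assoc)
    have "solves A x"
      unfolding solves_def by (intro conjI allI impI cont deriv) auto
    then have nonneg: "x s = 0" if "0 \<le> s" for s
      using solves_eq_0[of A x t s] A c that \<open>0 \<le> t\<close> by (auto simp: x_def intro: continuous_on_subset)
    have "solves (\<lambda>s. - A (- s)) (\<lambda>s. x (- s))"
      unfolding solves_def
    proof (intro conjI allI impI)
      show "continuous_on {0..} (\<lambda>s. x (- s))"
        by (intro continuous_on_compose2[OF cont] continuous_intros) auto
      fix s :: real assume "0 < s"
      then have "(x has_vector_derivative \<bar>- s\<bar> powr (\<alpha> - 1) *\<^sub>R (A (- s) *v x (- s))) (at (- s))"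
        by (intro deriv) auto
      from vector_diff_chain_at[of uminus "- 1" s, OF _ this]
      have "((\<lambda>s. x (- s)) has_vector_derivative
          - (\<bar>s\<bar> powr (\<alpha> - 1) *\<^sub>R (A (- s) *v x (- s)))) (at s)"
        by (simp add: o_def has_vector_derivative_minus)
      then show "((\<lambda>s. x (- s)) has_vector_derivative
          \<bar>s\<bar> powr (\<alpha> - 1) *\<^sub>R (- A (- s) *v x (- s))) (at s)"
        using matrix_vector_mult_diff_rdistrib[of 0 "A (- s)" "x (- s)"] by simp
    qed
    moreover have "continuous_on {0..} (\<lambda>s. - A (- s))"
      by (intro continuous_intros continuous_on_compose2[OF A]) auto
    ultimately have nonpos: "x (- s) = 0" if "0 \<le> s" for s
      using solves_eq_0[of "\<lambda>s. - A (- s)" "\<lambda>s. x (- s)" 0 s] nonneg[of 0] that by simp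
    have "x s = 0" for s
      using nonneg[of s] nonpos[of "- s"] by (cases "0 \<le> s") auto
    then have "\<forall>s. (\<Sum>j\<in>UNIV. c $ j *\<^sub>R column j (X s)) = 0"
      by (simp add: x_def matrix_mult_sum scalar_mult_eq_scaleR)
    then show ?thesis using X unfolding fundamental_matrix_def vec_eq_iff by auto
  qed
  then show ?thesis by (simp add: invertible_left_inverse matrix_left_invertible_ker)
qed

text \<open>Passing to the smaller exponent and larger constant only weakens the estimate, since
  t^\<alpha> / \<alpha> increases. The unstable estimate uses it with the two times
  interchanged.\<close>

lemma dichotomy_weight_le:
  fixes \<alpha> b c s t :: real
  assumes "0 < \<alpha>" "0 \<le> s" "s \<le> t" "b \<le> c" "0 \<le> M" "M \<le> N"
  shows "M * (mittag_leffler_E \<alpha> c s / mittag_leffler_E \<alpha> c t)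
    \<le> N * exp (- b * (t powr \<alpha> / \<alpha> - s powr \<alpha> / \<alpha>))"
proof -
  have "b * (t powr \<alpha> / \<alpha> - s powr \<alpha> / \<alpha>) \<le> c * (t powr \<alpha> / \<alpha> - s powr \<alpha> / \<alpha>)"
    using assms by (intro mult_right_mono) (auto simp: powr_mono2 divide_right_mono)
  then show ?thesis
    using assms unfolding mittag_leffler_E_def exp_diff[symmetric]
    by (intro mult_mono) (auto simp: right_diff_distrib)
qed

theorem corollary4p1:
  fixes \<alpha> N1 N2 \<beta>1 \<beta>2 N \<beta> \<epsilon> :: real
    and A B X Y :: "real \<Rightarrow> real ^ 'n ^ 'n"
    and P :: "real ^ 'n ^ 'n"
  assumes "0 < \<alpha>" and "\<alpha> \<le> 1"
    and "continuous_on UNIV A"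
    and "continuous_on UNIV B" and "bounded (range B)"
    and "mittag_leffler_dichotomy \<alpha> A X P N1 N2 \<beta>1 \<beta>2"
    and "N = max N1 N2" and "N \<ge> 1"
    and "\<beta> = min \<beta>1 \<beta>2"
    and "\<epsilon> = (SUP t\<in>{0..}. colsum_norm (B t))"
    and "\<epsilon> < \<beta> / (5 * N\<^sup>2)"
    and "fundamental_matrix \<alpha> (\<lambda>t. A t + B t) Y" and "Y 0 = mat 1"
  shows "\<exists>Q :: real ^ 'n ^ 'n. Q ** Q = Q \<and> rank Q = rank P \<and>
     (\<forall>t s. 0 \<le> s \<and> s \<le> t \<longrightarrow>
        colsum_norm (Y t ** Q ** matrix_inv (Y s))
          \<le> 25 * N\<^sup>2 / 9 *
             (mittag_leffler_E \<alpha> (\<beta> - 3 * \<epsilon> * N) s / mittag_leffler_E \<alpha> (\<beta> - 3 * \<epsilon> * N) t)) \<and>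
     (\<forall>t s. 0 \<le> t \<and> t \<le> s \<longrightarrow>
        colsum_norm (Y t ** (mat 1 - Q) ** matrix_inv (Y s))
          \<le> 25 * N\<^sup>2 / 9 *
             (mittag_leffler_E \<alpha> (\<beta> - 3 * \<epsilon> * N) t / mittag_leffler_E \<alpha> (\<beta> - 3 * \<epsilon> * N) s)) \<and>
     (\<forall>t\<ge>0. colsum_norm (Y t ** Q ** matrix_inv (Y t) - X t ** P ** matrix_inv (X t))
          \<le> 2 * \<epsilon> * N ^ 3 / (2 * \<beta> - 5 * \<epsilon> * N - 2 * \<epsilon> * N\<^sup>2))"
proof -
  have X: "fundamental_matrix \<alpha> A X" and P: "P ** P = P"
    and pos: "N1 > 0" "N2 > 0" "\<beta>1 > 0" "\<beta>2 > 0"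
    and dich1: "\<And>t s. 0 \<le> s \<Longrightarrow> s \<le> t \<Longrightarrow> colsum_norm (X t ** P ** matrix_inv (X s))
        \<le> N1 * (mittag_leffler_E \<alpha> \<beta>1 s / mittag_leffler_E \<alpha> \<beta>1 t)"
    and dich2: "\<And>t s. 0 \<le> t \<Longrightarrow> t \<le> s \<Longrightarrow> colsum_norm (X t ** (mat 1 - P) ** matrix_inv (X s))
        \<le> N2 * (mittag_leffler_E \<alpha> \<beta>2 t / mittag_leffler_E \<alpha> \<beta>2 s)"
    using assms(6) unfolding mittag_leffler_dichotomy_def by auto
  note Y = assms(12)
  interpret time_change "\<lambda>t. t powr \<alpha> / \<alpha>" "\<lambda>t. \<bar>t\<bar> powr (\<alpha> - 1)"
    by (rule time_change_powr) fact
  interpret dichotomy_perturbation "\<lambda>t. t powr \<alpha> / \<alpha>" "\<lambda>t. \<bar>t\<bar> powr (\<alpha> - 1)" A B X Y P N \<beta> \<epsilon>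
  proof
    show "colsum_norm (X t ** P ** matrix_inv (X s))
        \<le> N * exp (- \<beta> * (t powr \<alpha> / \<alpha> - s powr \<alpha> / \<alpha>))" if "0 \<le> s" "s \<le> t" for s t
      by (rule order_trans[OF dich1[OF that] dichotomy_weight_le]) (use assms pos that in auto)
    show "colsum_norm (X t ** (mat 1 - P) ** matrix_inv (X s))
        \<le> N * exp (- \<beta> * (s powr \<alpha> / \<alpha> - t powr \<alpha> / \<alpha>))" if "0 \<le> t" "t \<le> s" for s t
      by (rule order_trans[OF dich2[OF that] dichotomy_weight_le]) (use assms pos that in auto)
    show "colsum_norm (B t) \<le> \<epsilon>" if "0 \<le> t" for t
    proof -
      have "bdd_above ((\<lambda>t. colsum_norm (B t)) ` {0..})"
        by (rule bdd_above_mono[OF bounded_colsum_norm[OF assms(5)]]) auto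
      with that show ?thesis unfolding assms(10) by (intro cSUP_upper) auto
    qed
    show "0 < \<beta>" using assms(9) pos by simp
    show "5 * N\<^sup>2 * \<epsilon> < \<beta>"
      using assms(8,11) by (simp add: pos_less_divide_eq mult.commute)
    show "invertible (X t)" "invertible (Y t)" if "0 \<le> t" for t
      by (rule fundamental_matrix_invertible[OF assms(1) _ X that]
          fundamental_matrix_invertible[OF assms(1) _ Y that]; intro continuous_intros assms)+
    show "(X has_vector_derivative \<bar>t\<bar> powr (\<alpha> - 1) *\<^sub>R (A t ** X t)) (at t)"
      "(Y has_vector_derivative \<bar>t\<bar> powr (\<alpha> - 1) *\<^sub>R ((A t + B t) ** Y t)) (at t)" if "0 < t" for t
      using fundamental_matrix_deriv[OF X, of t] fundamental_matrix_deriv[OF Y, of t] that by simp_all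
  qed (use X Y P assms(8,13) in \<open>auto intro: fundamental_matrix_continuous\<close>)
  have weight: "exp (- c * (t powr \<alpha> / \<alpha> - s powr \<alpha> / \<alpha>)) =
      mittag_leffler_E \<alpha> c s / mittag_leffler_E \<alpha> c t" for c s t
    by (simp add: mittag_leffler_E_def exp_diff[symmetric] right_diff_distrib)
  show ?thesis
    using ex_perturbed_projection unfolding weight by (metis (no_types, lifting))
qed

end
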